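(* Let $n\ge 2$, $s\ge 1$ and $1\le p\le n$. There exist an $s$-John domain $\Omega\subset\mathbb{R}^n$, with central Whitney cube $Q_0$, and a sequence of compact sets $E_j\subset\Omega$, $j=1,2,\dots$, with the following properties: 1. each $E_j$ is disjoint from $Q_0$; 2. whenever $0<q<\min\{(n-1)s+1-p,\;n\}$, the Hausdorff contents $\mathcal{H}^q_\infty(E_j)$ are bounded from below by a positive constant independent of $j$, and $\operatorname{Cap}_p(E_j,Q_0,\Omega)\to 0$ as $j\to\infty$.
   Context: **$s$-John domain.** For $s\ge 1$, a bounded domain $\Omega\subset\mathbb{R}^n$ is an $s$-John domain if there are a constant $C_0$ and a point $x_0\in\Omega$ (the John center) such that for each $x\in\Omega$ there is a rectifiable curve $\gamma:[0,1]\to\Omega$ with $\gamma(0)=x$, $\gamma(1)=x_0$ and $$C_0\, d(\gamma(t),\partial\Omega)\ge \big(l(\gamma([0,t]))\big)^s\quad\text{for each }0<t\le 1,$$ where $d(\cdot,\partial\Omega)$ is the distance to the boundary and $l$ denotes length. **Whitney decomposition and central cube.** A Whitney decomposition $\mathbb{W}$ of $\Omega$ is a collection of closed cubes $Q\subset\Omega$ with pairwise disjoint interiors and edges parallel to the coordinate axes, such that $\Omega=\bigcup_{Q\in\mathbb{W}}Q$, the diameters of the cubes belong to $\{2^{-j}:j\in\mathbb{Z}\}$, and $\operatorname{diam}(Q)\le\operatorname{dist}(Q,\partial\Omega)\le 4\operatorname{diam}(Q)$ for every $Q\in\mathbb{W}$. A Whitney decomposition of $\Omega$ is fixed, and the central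 Whitney cube $Q_0$ is the fixed Whitney cube containing the John center $x_0$. **Hausdorff content.** For $0<q<\infty$ and $E\subset\mathbb{R}^n$, $\mathcal{H}^q_\infty(E)=\inf\sum_i r_i^q$, where the infimum is over all coverings of $E$ by balls $B(x_i,r_i)$, $i=1,2,\dots$. **Capacity.** For disjoint compact sets $E,F\subset\Omega$, $\operatorname{Cap}_p(E,F,\Omega)=\inf_u\int_\Omega|\nabla u(x)|^p\,dx$, where the infimum is over all continuous functions $u\in W^{1,p}_{loc}(\Omega)$ with $u(x)\le 0$ for $x\in E$ and $u(x)\ge 1$ for $x\in F$. *)

theory Defs
  imports "HOL-Analysis.Analysis"
begin

section \<open>Rectifiable curves and s-John domains\<close>

text \<open>Length of the curve obtained by restricting \<open>\<gamma>\<close> to \<open>[a, b]\<close>, as the supremum of the lengths of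
  inscribed polygons (so parts of the image traversed repeatedly are counted repeatedly).\<close>

definition curve_length :: "(real \<Rightarrow> 'a::metric_space) \<Rightarrow> real \<Rightarrow> real \<Rightarrow> ennreal" where
  "curve_length \<gamma> a b =
     (SUP (m, \<tau>) \<in> {(m :: nat, \<tau> :: nat \<Rightarrow> real). mono_on {..m} \<tau> \<and> \<tau> ` {..m} \<subseteq> {a..b}}.
        \<Sum>i<m. ennreal (dist (\<gamma> (\<tau> i)) (\<gamma> (\<tau> (Suc i)))))"

definition rectifiable_curve :: "(real \<Rightarrow> 'a::metric_space) \<Rightarrow> bool" where
  "rectifiable_curve \<gamma> \<longleftrightarrow> path \<gamma> \<and> curve_length \<gamma> 0 1 < \<infinity>"

definition s_John_domain :: "real \<Rightarrow> 'a::euclidean_space set \<Rightarrow> 'a \<Rightarrow> bool" where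
  "s_John_domain s \<Omega> x0 \<longleftrightarrow>
     open \<Omega> \<and> connected \<Omega> \<and> bounded \<Omega> \<and> x0 \<in> \<Omega> \<and>
     (\<exists>C0>0. \<forall>x\<in>\<Omega>. \<exists>\<gamma>. rectifiable_curve \<gamma> \<and> path_image \<gamma> \<subseteq> \<Omega> \<and>
        pathstart \<gamma> = x \<and> pathfinish \<gamma> = x0 \<and>
        (\<forall>t. 0 < t \<and> t \<le> 1 \<longrightarrow>
           C0 * infdist (\<gamma> t) (frontier \<Omega>) \<ge> enn2real (curve_length \<gamma> 0 t) powr s))"

section \<open>Whitney decompositions\<close>

definition closed_cube :: "'a::euclidean_space set \<Rightarrow> bool" where
  "closed_cube Q \<longleftrightarrow> (\<exists>a h. h > 0 \<and> Q = cbox a (a + h *\<^sub>R One))"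

definition Whitney_decomposition :: "'a::euclidean_space set \<Rightarrow> 'a set set \<Rightarrow> bool" where
  "Whitney_decomposition \<Omega> W \<longleftrightarrow>
     (\<forall>Q\<in>W. closed_cube Q \<and> Q \<subseteq> \<Omega> \<and>
        (\<exists>j::int. diameter Q = 2 powi (- j)) \<and>
        diameter Q \<le> setdist Q (frontier \<Omega>) \<and>
        setdist Q (frontier \<Omega>) \<le> 4 * diameter Q) \<and>
     pairwise (\<lambda>Q R. interior Q \<inter> interior R = {}) W \<and>
     \<Union>W = \<Omega>"

section \<open>Hausdorff content\<close>

definition Hausdorff_content :: "real \<Rightarrow> 'a::metric_space set \<Rightarrow> ennreal" where
  "Hausdorff_content q E =
     (INF (x, r) \<in> {(x :: nat \<Rightarrow> 'a, r :: nat \<Rightarrow> real).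
                      (\<forall>i. r i > 0) \<and> E \<subseteq> (\<Union>i. ball (x i) (r i))}.
        \<Sum>i. ennreal (r i powr q))"

section \<open>Local Sobolev functions and capacity\<close>

fun k_times_cont_diff :: "nat \<Rightarrow> (real^'n \<Rightarrow> real) \<Rightarrow> bool" where
  "k_times_cont_diff 0 f \<longleftrightarrow> continuous_on UNIV f"
| "k_times_cont_diff (Suc k) f \<longleftrightarrow>
     (\<forall>x. f differentiable (at x)) \<and>
     (\<forall>i. k_times_cont_diff k (\<lambda>x. frechet_derivative f (at x) (axis i 1)))"

definition test_function :: "(real^'n) set \<Rightarrow> (real^'n \<Rightarrow> real) \<Rightarrow> bool" where
  "test_function \<Omega> \<phi> \<longleftrightarrow>
     (\<forall>k. k_times_cont_diff k \<phi>) \<and>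
     compact (closure {x. \<phi> x \<noteq> 0}) \<and> closure {x. \<phi> x \<noteq> 0} \<subseteq> \<Omega>"

definition Lp_loc :: "real \<Rightarrow> 'a::euclidean_space set \<Rightarrow> ('a \<Rightarrow> 'b::euclidean_space) set" where
  "Lp_loc p \<Omega> = {f. set_borel_measurable lebesgue \<Omega> f \<and>
     (\<forall>K. compact K \<and> K \<subseteq> \<Omega> \<longrightarrow> set_integrable lebesgue K (\<lambda>x. norm (f x) powr p))}"

definition weak_gradient :: "(real^'n) set \<Rightarrow> (real^'n \<Rightarrow> real) \<Rightarrow> (real^'n \<Rightarrow> real^'n) \<Rightarrow> bool" where
  "weak_gradient \<Omega> u g \<longleftrightarrow>
     u \<in> Lp_loc 1 \<Omega> \<and> g \<in> Lp_loc 1 \<Omega> \<and>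
     (\<forall>\<phi> i. test_function \<Omega> \<phi> \<longrightarrow>
        (LINT x:\<Omega>|lebesgue. u x * frechet_derivative \<phi> (at x) (axis i 1)) =
        - (LINT x:\<Omega>|lebesgue. g x $ i * \<phi> x))"

definition W1p_loc :: "real \<Rightarrow> (real^'n) set \<Rightarrow> (real^'n \<Rightarrow> real) set" where
  "W1p_loc p \<Omega> = {u \<in> Lp_loc p \<Omega>. \<exists>g \<in> Lp_loc p \<Omega>. weak_gradient \<Omega> u g}"

text \<open>The infimum also ranges over the representatives \<open>g\<close> of the weak gradient of \<open>u\<close>; these agree
  almost everywhere on \<open>\<Omega>\<close>, so the integral depends on \<open>u\<close> alone.\<close>

definition Capacity :: "real \<Rightarrow> (real^'n) set \<Rightarrow> (real^'n) set \<Rightarrow> (real^'n) set \<Rightarrow> ennreal" where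
  "Capacity p E F \<Omega> =
     (INF (u, g) \<in> {(u, g). continuous_on \<Omega> u \<and> u \<in> W1p_loc p \<Omega> \<and> weak_gradient \<Omega> u g \<and>
                       (\<forall>x\<in>E. u x \<le> 0) \<and> (\<forall>x\<in>F. u x \<ge> 1)}.
        \<integral>\<^sup>+x\<in>\<Omega>. ennreal (norm (g x) powr p) \<partial>lebesgue)"

end

theory Submission
  imports Defs "HOL-Real_Asymp.Real_Asymp"
begin

text \<open>
  The domain is a tree of rooms joined by passages. The node of level \<open>k\<close> carries a cubical room of
  half-side \<open>r k\<close>, from whose centre a passage of half-width \<open>w k\<close> (comparable to the \<open>s\<close>-th power of
  its length) runs in both directions of the coordinate axis \<open>\<alpha> k\<close> to the two nodes of level
  \<open>k + 1\<close>; the axes are used cyclically, so the subtrees sit in nested boxes like the pieces of a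
  Cantor set. The tree is symmetric under reflections, so it is described by folding: applying
  \<open>z\<^sub>\<alpha> \<mapsto> \<bar>z\<^sub>\<alpha>\<bar> - h k\<close> in the axes \<open>\<alpha> 0, \<dots>, \<alpha> (k - 1)\<close> moves every node of level \<open>k\<close> to the origin.

  Up to constants the capacity between the rooms of level \<open>j + 1\<close> and the centre is at most the number
  \<open>2\<^sup>j\<close> of passages of level \<open>j\<close> times the energy of a function that is linear along a passage. If the
  boxes of level \<open>k\<close> have size \<open>B k = 2\<^sup>-\<^sup>k\<^sup>/\<^sup>\<lambda> (k + 1)\<^sup>-\<^sup>M\<close> with \<open>\<lambda> = min ((n - 1) s + 1 - p) n\<close> and
  large \<open>M\<close>, this tends to 0, while the rooms of level \<open>j\<close> carry uniformly positive \<open>q\<close>-content for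
  every \<open>q < \<lambda>\<close>. The logarithmic correction \<open>(k + 1)\<^sup>-\<^sup>M\<close> also leaves gaps between the subtrees when
  \<open>\<lambda> = n\<close>; these are large compared with \<open>w k\<close> because \<open>\<lambda> = n\<close> forces \<open>s > 1\<close>.
\<close>

section \<open>Existence of Whitney decompositions\<close>

text \<open>Rounding down assigns every \<open>x\<close> to exactly one closed cube of mesh
  \<open>h\<close>, although neighbouring cubes share faces.\<close>

definition grid_cube :: "real \<Rightarrow> 'a::euclidean_space \<Rightarrow> 'a set" where
  "grid_cube h x = (let a = (\<Sum>b\<in>Basis. (h * of_int \<lfloor>x \<bullet> b / h\<rfloor>) *\<^sub>R b) in cbox a (a + h *\<^sub>R One))"

lemma mem_grid_cube:
  assumes "h > 0"
  shows "y \<in> grid_cube h x \<longleftrightarrow>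
    (\<forall>b\<in>Basis. of_int \<lfloor>x \<bullet> b / h\<rfloor> \<le> y \<bullet> b / h \<and> y \<bullet> b / h \<le> of_int \<lfloor>x \<bullet> b / h\<rfloor> + 1)"
  using assms by (auto simp: grid_cube_def Let_def mem_box inner_add_left pos_le_divide_eq
      pos_divide_le_eq algebra_simps)

lemma self_mem_grid_cube: "h > 0 \<Longrightarrow> x \<in> grid_cube h x"
  by (simp add: mem_grid_cube)

lemma diameter_grid_cube: "h > 0 \<Longrightarrow> diameter (grid_cube h (x::'a)) = h * norm (One::'a::euclidean_space)"
  unfolding grid_cube_def Let_def
  by (subst diameter_cbox) (auto simp: inner_add_left dist_norm)

text \<open>Dyadic nesting: the end points of the coarse cells are among those of the fine cells,
  which in coordinates is \<open>2 * \<lfloor>t / 2\<rfloor> \<le> \<lfloor>t\<rfloor> \<le> 2 *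
  \<lfloor>t / 2\<rfloor> + 1\<close>.\<close>

lemma grid_cube_double:
  assumes "h > 0" shows "grid_cube h x \<subseteq> grid_cube (2 * h) x"
proof
  fix y assume y: "y \<in> grid_cube h x"
  have "of_int \<lfloor>x \<bullet> b / (2*h)\<rfloor> \<le> y \<bullet> b / (2*h) \<and> y \<bullet> b / (2*h) \<le> of_int \<lfloor>x \<bullet> b / (2*h)\<rfloor> + 1"
    if b: "b \<in> Basis" for b
  proof -
    define t where "t = x \<bullet> b / h"
    define v where "v = y \<bullet> b / h"
    have e: "x \<bullet> b / (2*h) = t / 2" "y \<bullet> b / (2*h) = v / 2" by (simp_all add: t_def v_def)
    have v: "of_int \<lfloor>t\<rfloor> \<le> v" "v \<le> of_int \<lfloor>t\<rfloor> + 1"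
      using y b by (auto simp: mem_grid_cube[OF assms] t_def v_def)
    have "2 * \<lfloor>t / 2\<rfloor> \<le> \<lfloor>t\<rfloor>" "\<lfloor>t\<rfloor> \<le> 2 * \<lfloor>t/2\<rfloor> + 1" by linarith+
    then have "of_int (2 * \<lfloor>t / 2\<rfloor>) \<le> (of_int \<lfloor>t\<rfloor> :: real)" "(of_int \<lfloor>t\<rfloor>::real) \<le> of_int (2 * \<lfloor>t/2\<rfloor> + 1)"
      by (simp_all only: of_int_le_iff)
    then show ?thesis unfolding e using v by auto
  qed
  then show "y \<in> grid_cube (2 * h) x" using assms by (simp add: mem_grid_cube)
qed

lemma floor_eq_of_mem_interior_grid_cube:
  assumes "h > 0" "z \<in> interior (grid_cube h x)" "b \<in> Basis"
  shows "\<lfloor>z \<bullet> b / h\<rfloor> = \<lfloor>x \<bullet> b / h\<rfloor>"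
proof -
  have "h * of_int \<lfloor>x \<bullet> b / h\<rfloor> < z \<bullet> b" "z \<bullet> b < h * of_int \<lfloor>x \<bullet> b / h\<rfloor> + h"
    using assms by (auto simp: grid_cube_def Let_def interior_cbox mem_box inner_add_left)
  then have "of_int \<lfloor>x \<bullet> b / h\<rfloor> \<le> z \<bullet> b / h" "z \<bullet> b / h < of_int \<lfloor>x \<bullet> b / h\<rfloor> + 1"
    using assms(1) by (auto simp: field_simps)
  then show ?thesis by linarith
qed

lemma grid_cube_cong: "(\<And>b. b \<in> Basis \<Longrightarrow> \<lfloor>z \<bullet> b / h\<rfloor> = \<lfloor>x \<bullet> b / h\<rfloor>) \<Longrightarrow> grid_cube h z = grid_cube h x"
  by (simp add: grid_cube_def)

lemma floor_half_cong: "\<lfloor>t::real\<rfloor> = \<lfloor>v::real\<rfloor> \<Longrightarrow> \<lfloor>t / 2\<rfloor> = \<lfloor>v / 2\<rfloor>"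
  using floor_divide_real_eq_div[of 2 t] floor_divide_real_eq_div[of 2 v] by simp

text \<open>A stopping rule on dyadic grids: a cube is kept if its diameter is at most its distance
  to the frontier while its parent violates this. Small cubes about a point satisfy the condition
  and large ones do not, so every point is covered.\<close>

lemma ex_Whitney_decomposition:
  fixes \<Omega> :: "'a::euclidean_space set"
  assumes "open \<Omega>" "bounded \<Omega>" "\<Omega> \<noteq> {}"
  shows "\<exists>W. Whitney_decomposition \<Omega> W"
proof -
  have F: "frontier \<Omega> \<noteq> {}"
    using assms by (metis frontier_not_empty not_bounded_UNIV)
  have disj: "x \<notin> frontier \<Omega>" if "x \<in> \<Omega>" for x
    using that assms(1) by (simp add: frontier_def interior_open)
  define \<kappa> where "\<kappa> = norm (One::'a)"
  have \<kappa>: "\<kappa> > 0" by (simp add: \<kappa>_def)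
  \<comment> \<open>Dividing by \<open>\<kappa>\<close>, the diagonal of the unit cube, makes the
    diameters rather than the sides powers of 2.\<close>
  define h where "h = (\<lambda>j::int. 2 powi (-j) / \<kappa>)"
  have h: "h j > 0" "h (j - 1) = 2 * h j" for j
    using \<kappa> by (simp_all add: h_def power_int_diff power_int_minus field_simps)
  define Q where "Q = (\<lambda>j x. grid_cube (h j) (x::'a))"
  have diam: "diameter (Q j x) = 2 powi (-j)" for j x
    using \<kappa> h by (simp add: Q_def diameter_grid_cube h_def flip: \<kappa>_def)
  have Qne: "x \<in> Q j x" for j x by (simp add: Q_def self_mem_grid_cube h)
  have Qpar: "Q j x \<subseteq> Q (j - 1) x" for j x
    using grid_cube_double[of "h j" x] h by (simp add: Q_def)
  have bddQ: "bounded (Q j x)" for j x by (simp add: Q_def grid_cube_def Let_def)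
  have Qmono: "Q j x \<subseteq> Q (j - int m) x" for j m x
  proof (induction m)
    case (Suc m)
    have "j - int (Suc m) = j - int m - 1" by simp
    then show ?case using Suc Qpar[of "j - int m" x] by (metis subset_trans)
  qed simp
  define good where "good = (\<lambda>Q. diameter Q \<le> setdist Q (frontier \<Omega>))"
  have good_small: "\<exists>m. good (Q (int m) x)" if x: "x \<in> \<Omega>" for x
  proof -
    define d where "d = infdist x (frontier \<Omega>)"
    have d: "d > 0" unfolding d_def
      using infdist_pos_not_in_closed[OF frontier_closed F disj[OF x]] .
    obtain m where m: "(1/2::real) ^ m < d / 2" using real_arch_pow_inv[of "d/2" "1/2"] d by auto
    have "diameter (Q (int m) x) \<le> setdist (Q (int m) x) (frontier \<Omega>)"
    proof (rule le_setdistI)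
      show "Q (int m) x \<noteq> {}" using Qne by blast
      show "frontier \<Omega> \<noteq> {}" by (rule F)
      fix y z assume yz: "y \<in> Q (int m) x" "z \<in> frontier \<Omega>"
      have "d \<le> dist x z" unfolding d_def by (rule infdist_le[OF yz(2)])
      moreover have "dist x y \<le> diameter (Q (int m) x)"
        by (rule diameter_bounded_bound[OF bddQ Qne yz(1)])
      moreover have "diameter (Q (int m) x) < d / 2"
        using m by (simp add: diam power_int_minus power_one_over field_simps)
      ultimately show "diameter (Q (int m) x) \<le> dist y z"
        using dist_triangle[of x z y] by linarith
    qed
    then show ?thesis by (auto simp: good_def)
  qed
  have bad_large: "\<exists>j0. \<forall>j\<le>j0. \<not> good (Q j x)" for x
  proof -
    define d where "d = infdist x (frontier \<Omega>)"
    obtain m where m: "d < 2 ^ m" using real_arch_pow[of 2 d] by auto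
    have "\<not> good (Q j x)" if "j \<le> - int m" for j
    proof -
      have "(2::real) ^ m = 2 powi (int m)" by simp
      also have "\<dots> \<le> 2 powi (-j)" using that by (intro power_int_increasing) auto
      also have "\<dots> = diameter (Q j x)" by (simp add: diam)
      finally have "d < diameter (Q j x)" using m by simp
      moreover have "setdist (Q j x) (frontier \<Omega>) \<le> setdist {x} (frontier \<Omega>)"
        using Qne[of x j] by (intro setdist_subset_left) auto
      moreover have "setdist {x} (frontier \<Omega>) = d"
        using F by (simp add: d_def infdist_eq_setdist)
      ultimately show ?thesis by (simp add: good_def)
    qed
    then show ?thesis by blast
  qed
  \<comment> \<open>The first good scale after one below which all cubes are bad.\<close>
  have ex_j: "\<exists>j. good (Q j x) \<and> \<not> good (Q (j - 1) x)" if x: "x \<in> \<Omega>" for x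
  proof -
    obtain j0 where j0: "\<And>j. j \<le> j0 \<Longrightarrow> \<not> good (Q j x)" using bad_large[of x] by blast
    obtain m where m: "good (Q (int m) x)" using good_small[OF x] by blast
    have mj: "int m > j0" using j0[of "int m"] m by linarith
    then have "\<exists>i. good (Q (j0 + int i) x)" using m by (intro exI[of _ "nat (int m - j0)"]) simp
    define i where "i = (LEAST i. good (Q (j0 + int i) x))"
    have gi: "good (Q (j0 + int i) x)" unfolding i_def by (rule LeastI_ex) fact
    have "i \<noteq> 0" using gi j0[of j0] by (intro notI) simp
    then obtain i' where i': "i = Suc i'" by (cases i) auto
    have "\<not> good (Q (j0 + int i') x)" using not_less_Least[of i' "\<lambda>i. good (Q (j0 + int i) x)"] i'
      by (simp add: i_def[symmetric])
    then show ?thesis using gi i' by (intro exI[of _ "j0 + int i"]) simp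
  qed
  have sub: "Q j x \<subseteq> \<Omega>" if "x \<in> \<Omega>" "good (Q j x)" for j x
  proof (rule ccontr)
    assume "\<not> Q j x \<subseteq> \<Omega>"
    moreover have "connected (Q j x)"
      by (simp add: Q_def grid_cube_def Let_def convex_connected convex_box)
    ultimately have "Q j x \<inter> frontier \<Omega> \<noteq> {}"
      using that Qne[of x j] by (intro connected_Int_frontier) auto
    then have "setdist (Q j x) (frontier \<Omega>) = 0" by (auto intro: setdist_eq_0I)
    moreover have "diameter (Q j x) > 0" by (simp add: diam)
    ultimately show False using that(2) by (simp add: good_def)
  qed
  define W where "W = {Q j x |j x. x \<in> \<Omega> \<and> good (Q j x) \<and> \<not> good (Q (j - 1) x)}"
  have "closed_cube R \<and> R \<subseteq> \<Omega> \<and> (\<exists>j::int. diameter R = 2 powi (- j)) \<and>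
        diameter R \<le> setdist R (frontier \<Omega>) \<and> setdist R (frontier \<Omega>) \<le> 4 * diameter R"
    if RW: "R \<in> W" for R
  proof -
    obtain j x where R: "R = Q j x" "x \<in> \<Omega>" "good (Q j x)" "\<not> good (Q (j - 1) x)"
      using RW by (auto simp: W_def)
    have cc: "closed_cube R"
      unfolding closed_cube_def R(1) Q_def grid_cube_def Let_def using h by blast
    have dp: "diameter (Q (j-1) x) = 2 * diameter (Q j x)"
      by (simp add: diam power_int_diff power_int_minus field_simps)
    \<comment> \<open>The upper Whitney bound: the parent has twice the diameter and lies closer to
      the frontier than that, so crossing the parent and then the remaining distance costs at most 2
      + 2 diameters.\<close>
    have "setdist (Q (j-1) x) (frontier \<Omega>) < 2 * diameter (Q j x)"
      using R(4) dp by (simp add: good_def)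
    then obtain y z where yz: "y \<in> Q (j-1) x" "z \<in> frontier \<Omega>" "dist y z < 2 * diameter (Q j x)"
      by (smt (verit) F Qne empty_iff le_setdistI)
    have "setdist (Q j x) (frontier \<Omega>) \<le> dist x z"
      by (rule setdist_le_dist[OF Qne yz(2)])
    also have "\<dots> \<le> dist x y + dist y z" by (rule dist_triangle)
    also have "dist x y \<le> diameter (Q (j-1) x)"
      by (rule diameter_bounded_bound[OF bddQ Qne yz(1)])
    finally have "setdist (Q j x) (frontier \<Omega>) \<le> 4 * diameter (Q j x)" using dp yz(3) by linarith
    then show ?thesis using R sub[OF R(2,3)] cc diam[of j x] by (auto simp: good_def)
  qed
  moreover have "pairwise (\<lambda>Q R. interior Q \<inter> interior R = {}) W"
  proof -
    \<comment> \<open>Two kept cubes with a common interior point have the same scale: otherwise the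
      larger one contains the parent of the smaller one, and this parent inherits goodness.\<close>
    have *: "\<not> i < j" 
      if "z \<in> interior (Q j x)" "z \<in> interior (Q i y)" "good (Q i y)" "\<not> good (Q (j - 1) x)" for z i j x y
    proof
      assume ij: "i < j"
      have "\<lfloor>z \<bullet> b / h j\<rfloor> = \<lfloor>x \<bullet> b / h j\<rfloor>" if "b \<in> Basis" for b
        using floor_eq_of_mem_interior_grid_cube[of "h j" z x b] h \<open>z \<in> interior (Q j x)\<close> that
        by (simp add: Q_def)
      then have "\<lfloor>z \<bullet> b / h (j-1)\<rfloor> = \<lfloor>x \<bullet> b / h (j-1)\<rfloor>" if "b \<in> Basis" for b
        using floor_half_cong[of "z \<bullet> b / h j" "x \<bullet> b / h j"] that by (simp add: h(2) mult.commute)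
      then have Qz: "Q (j-1) z = Q (j-1) x" unfolding Q_def by (rule grid_cube_cong)
      have "Q i z = Q i y" unfolding Q_def
        using floor_eq_of_mem_interior_grid_cube[of "h i" z y] h that(2)
        by (intro grid_cube_cong) (simp add: Q_def)
      moreover have "Q (j-1) z \<subseteq> Q i z" using Qmono[of "j-1" z "nat (j - 1 - i)"] ij by simp
      ultimately have s: "Q (j-1) x \<subseteq> Q i y" using Qz by simp
      have "diameter (Q (j-1) x) \<le> diameter (Q i y)"
        by (rule diameter_subset[OF s bddQ])
      also have "\<dots> \<le> setdist (Q i y) (frontier \<Omega>)" using that(3) by (simp add: good_def)
      also have "\<dots> \<le> setdist (Q (j-1) x) (frontier \<Omega>)"
        by (rule setdist_subset_left[OF _ s]) (use Qne in blast)
      finally show False using that(4) by (simp add: good_def)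
    qed
    have "R = T" if RT: "R \<in> W" "T \<in> W" and z: "z \<in> interior R" "z \<in> interior T" for R T z
    proof -
      obtain j x where R: "R = Q j x" "good (Q j x)" "\<not> good (Q (j - 1) x)"
        using RT by (auto simp: W_def)
      obtain i y where T: "T = Q i y" "good (Q i y)" "\<not> good (Q (i - 1) y)"
        using RT by (auto simp: W_def)
      have "i = j" using *[of z j x i y] *[of z i y j x] R T z by auto
      moreover have "Q j z = Q j x" "Q i z = Q i y" unfolding Q_def
        using floor_eq_of_mem_interior_grid_cube[of "h i" z y] 
          floor_eq_of_mem_interior_grid_cube[of "h j" z x] h z R(1) T(1)
        by (auto intro!: grid_cube_cong simp: Q_def)
      ultimately show ?thesis using R(1) T(1) by simp
    qed
    then show ?thesis unfolding pairwise_def by blast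
  qed
  moreover have "\<Union>W = \<Omega>"
  proof
    show "\<Union>W \<subseteq> \<Omega>" using sub by (auto simp: W_def)
    show "\<Omega> \<subseteq> \<Union>W"
    proof
      fix x assume x: "x \<in> \<Omega>"
      obtain j where j: "good (Q j x)" "\<not> good (Q (j - 1) x)" using ex_j[OF x] by blast
      then have "Q j x \<in> W" using x by (auto simp: W_def)
      then show "x \<in> \<Union>W" using Qne by blast
    qed
  qed
  ultimately have "Whitney_decomposition \<Omega> W" unfolding Whitney_decomposition_def by blast
  then show ?thesis ..
qed

section \<open>Lipschitz curves and John domains\<close>

text \<open>\<open>A\<close> is the length already travelled before \<open>x\<close>. A ball of radius 0 is empty, so \<open>\<gamma> t \<in> \<Omega>\<close> has
  to be demanded separately.\<close>

definition curve_to :: "real \<Rightarrow> real \<Rightarrow> 'a::real_normed_vector set \<Rightarrow> 'a \<Rightarrow> real \<Rightarrow> 'a \<Rightarrow> bool" where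
  "curve_to s c \<Omega> z A x \<longleftrightarrow> (\<exists>L\<ge>0. \<exists>\<gamma>. 1-lipschitz_on {0..L} \<gamma> \<and> \<gamma> 0 = x \<and> \<gamma> L = z \<and>
     (\<forall>t\<in>{0..L}. \<gamma> t \<in> \<Omega> \<and> ball (\<gamma> t) (c * (A + t) powr s) \<subseteq> \<Omega>))"

lemma curve_to_refl: "z \<in> \<Omega> \<Longrightarrow> ball z (c * A powr s) \<subseteq> \<Omega> \<Longrightarrow> curve_to s c \<Omega> z A z"
  unfolding curve_to_def by (intro exI[of _ 0] conjI exI[of _ "\<lambda>_. z"]) (auto simp: lipschitz_on_def)

text \<open>The segment is run through at unit speed before the given curve, so the parameter still
  bounds the length and the Lipschitz constant stays 1.\<close>

lemma curve_to_prepend: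
  assumes "\<And>\<theta>. 0 \<le> \<theta> \<Longrightarrow> \<theta> \<le> 1 \<Longrightarrow> x + \<theta> *\<^sub>R (y - x) \<in> \<Omega>"
    and "\<And>\<theta>. 0 \<le> \<theta> \<Longrightarrow> \<theta> \<le> 1 \<Longrightarrow> ball (x + \<theta> *\<^sub>R (y - x)) (c * (A + \<theta> * dist x y) powr s) \<subseteq> \<Omega>"
    and "curve_to s c \<Omega> z (A + dist x y) y"
  shows "curve_to s c \<Omega> z A x"
proof (cases "x = y")
  case True
  then show ?thesis using assms(3) by simp
next
  case False
  define D where "D = dist x y"
  have D: "D > 0" using False by (simp add: D_def)
  obtain L \<gamma> where L: "L \<ge> 0" "1-lipschitz_on {0..L} \<gamma>" "\<gamma> 0 = y" "\<gamma> L = z"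
    and \<gamma>: "\<And>t. t \<in> {0..L} \<Longrightarrow> \<gamma> t \<in> \<Omega> \<and> ball (\<gamma> t) (c * (A + D + t) powr s) \<subseteq> \<Omega>"
    using assms(3) unfolding curve_to_def D_def by auto
  define f where "f = (\<lambda>t. x + (t / D) *\<^sub>R (y - x))"
  have f: "1-lipschitz_on {0..D} f"
  proof (rule lipschitz_onI)
    fix t t' 
    have "f t - f t' = ((t - t') / D) *\<^sub>R (y - x)" by (simp add: f_def algebra_simps diff_divide_distrib)
    then have "dist (f t) (f t') = \<bar>(t - t') / D\<bar> * norm (y - x)" by (simp add: dist_norm)
    also have "norm (y - x) = D" by (simp add: D_def dist_norm norm_minus_commute)
    finally show "dist (f t) (f t') \<le> 1 * dist t t'" using D by (simp add: dist_real_def)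
  qed simp
  have g: "1-lipschitz_on {D..D + L} (\<lambda>t. \<gamma> (t - D))"
  proof (rule lipschitz_onI)
    fix t t' assume "t \<in> {D..D + L}" "t' \<in> {D..D + L}"
    then have "dist (\<gamma> (t - D)) (\<gamma> (t' - D)) \<le> 1 * dist (t - D) (t' - D)"
      by (intro lipschitz_onD[OF L(2)]) auto
    then show "dist (\<gamma> (t - D)) (\<gamma> (t' - D)) \<le> 1 * dist t t'" by (simp add: dist_real_def)
  qed simp
  define \<eta> where "\<eta> = (\<lambda>t. if t \<le> D then f t else \<gamma> (t - D))"
  have \<eta>: "1-lipschitz_on {0..D + L} \<eta>"
    unfolding \<eta>_def by (rule lipschitz_on_concat[OF f g]) (use D L(3) in \<open>simp add: f_def\<close>)
  have "\<eta> t \<in> \<Omega> \<and> ball (\<eta> t) (c * (A + t) powr s) \<subseteq> \<Omega>" if t: "t \<in> {0..D+L}" for t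
  proof (cases "t \<le> D")
    case True
    then have "0 \<le> t / D" "t / D \<le> 1" using D t by auto
    then show ?thesis using assms(1,2)[of "t/D"] True D by (simp add: \<eta>_def f_def flip: D_def)
  next
    case False
    then show ?thesis using \<gamma>[of "t - D"] t by (simp add: \<eta>_def)
  qed
  moreover have "\<eta> 0 = x" "\<eta> (D + L) = z" using D L by (auto simp: \<eta>_def f_def)
  moreover have "D + L \<ge> 0" using D L by simp
  ultimately show ?thesis unfolding curve_to_def using \<eta> by blast
qed

text \<open>The required radius increases with \<open>A\<close>, so an upper bound may stand in for
  the length already travelled.\<close>

lemma curve_to_mono:
  assumes "curve_to s c \<Omega> z A x" "0 \<le> A'" "A' \<le> A" "0 \<le> c" "0 \<le> s"
  shows "curve_to s c \<Omega> z A' x"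
proof -
  obtain L \<gamma> where L: "L \<ge> 0" "1-lipschitz_on {0..L} \<gamma>" "\<gamma> 0 = x" "\<gamma> L = z"
    and \<gamma>: "\<And>t. t \<in> {0..L} \<Longrightarrow> \<gamma> t \<in> \<Omega> \<and> ball (\<gamma> t) (c * (A + t) powr s) \<subseteq> \<Omega>"
    using assms(1) unfolding curve_to_def by auto
  have "\<gamma> t \<in> \<Omega> \<and> ball (\<gamma> t) (c * (A' + t) powr s) \<subseteq> \<Omega>" if t: "t \<in> {0..L}" for t
  proof -
    have "c * (A' + t) powr s \<le> c * (A + t) powr s"
      using assms t by (intro mult_left_mono powr_mono2) auto
    then show ?thesis using \<gamma>[OF t] by auto
  qed
  then show ?thesis unfolding curve_to_def using L by blast
qed

text \<open>In a corridor of constant clearance \<open>\<rho>\<close> the condition has to be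
  checked only at the far end, where the length travelled is greatest.\<close>

lemma curve_to_segment:
  assumes "\<And>v. v \<in> closed_segment x y \<Longrightarrow> ball v \<rho> \<subseteq> \<Omega>"
    and "\<rho> > 0" "0 \<le> c" "0 \<le> s" "0 \<le> A" "c * (A + dist x y) powr s \<le> \<rho>"
    and "curve_to s c \<Omega> z (A + dist x y) y"
  shows "curve_to s c \<Omega> z A x"
proof (rule curve_to_prepend[OF _ _ assms(7)])
  fix \<theta> :: real assume \<theta>: "0 \<le> \<theta>" "\<theta> \<le> 1"
  have "x + \<theta> *\<^sub>R (y - x) \<in> closed_segment x y"
    using \<theta> by (auto simp: in_segment algebra_simps intro!: exI[of _ \<theta>])
  from assms(1)[OF this] have b: "ball (x + \<theta> *\<^sub>R (y - x)) \<rho> \<subseteq> \<Omega>" .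
  then show "x + \<theta> *\<^sub>R (y - x) \<in> \<Omega>" using \<open>\<rho> > 0\<close> by (meson centre_in_ball subsetD)
  have "c * (A + \<theta> * dist x y) powr s \<le> c * (A + dist x y) powr s"
    using assms \<theta> by (intro mult_left_mono powr_mono2) (auto simp: mult_left_le_one_le)
  then show "ball (x + \<theta> *\<^sub>R (y - x)) (c * (A + \<theta> * dist x y) powr s) \<subseteq> \<Omega>"
    using b assms(6) subset_ball by (meson order_trans)
qed

text \<open>The first leg of a curve may start arbitrarily close to the frontier. By convexity
  \<open>P\<close> contains the ball of radius \<open>\<theta> * \<rho>\<close> about the point at
  fraction \<open>\<theta>\<close> of the segment, and \<open>\<theta> powr s \<le> \<theta>\<close>
  makes this ball large enough.\<close>

lemma curve_to_convex:
  assumes "convex P" "P \<subseteq> \<Omega>" "x \<in> P" "ball y \<rho> \<subseteq> P" "\<rho> > 0"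
    and "0 \<le> c" "1 \<le> s" "c * d powr s \<le> \<rho>" "dist x y \<le> d"
    and "curve_to s c \<Omega> z d y"
  shows "curve_to s c \<Omega> z 0 x"
proof (rule curve_to_prepend)
  show "curve_to s c \<Omega> z (0 + dist x y) y"
    using curve_to_mono[OF assms(10)] assms by simp
  fix \<theta> :: real assume \<theta>: "0 \<le> \<theta>" "\<theta> \<le> 1"
  have "y \<in> P" using assms(4,5) by (meson centre_in_ball subsetD)
  then have "(1 - \<theta>) *\<^sub>R x + \<theta> *\<^sub>R y \<in> P" using assms(1,3) \<theta> by (simp add: convexD)
  then show "x + \<theta> *\<^sub>R (y - x) \<in> \<Omega>" using assms(2) by (auto simp: algebra_simps)
  show "ball (x + \<theta> *\<^sub>R (y - x)) (c * (0 + \<theta> * dist x y) powr s) \<subseteq> \<Omega>"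
  proof (cases "\<theta> = 0")
    case True
    then show ?thesis using assms(7) by simp
  next
    case False
    then have \<theta>0: "\<theta> > 0" using \<theta> by simp
    have "c * (\<theta> * dist x y) powr s = c * (\<theta> powr s * dist x y powr s)"
      using \<theta> by (simp add: powr_mult)
    also have "\<dots> \<le> c * (\<theta> powr 1 * d powr s)"
      using \<theta>0 \<theta> assms by (intro mult_left_mono mult_mono powr_mono2 powr_mono') auto
    also have "\<dots> = \<theta> * (c * d powr s)" using \<theta>0 by simp
    also have "\<dots> \<le> \<theta> * \<rho>" using \<theta>0 assms(8) by simp
    finally have le: "c * (0 + \<theta> * dist x y) powr s \<le> \<theta> * \<rho>" by simp
    have "ball (x + \<theta> *\<^sub>R (y - x)) (\<theta> * \<rho>) \<subseteq> P"
    proof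
      fix v assume v: "v \<in> ball (x + \<theta> *\<^sub>R (y - x)) (\<theta> * \<rho>)"
      \<comment> \<open>\<open>u\<close> is the preimage of \<open>v\<close> under the homothety
        with centre \<open>x\<close> and ratio \<open>\<theta>\<close>.\<close>
      define u where "u = y + (1 / \<theta>) *\<^sub>R (v - (x + \<theta> *\<^sub>R (y - x)))"
      have "dist y u = (1/\<theta>) * dist (x + \<theta> *\<^sub>R (y - x)) v"
        using \<theta>0 by (simp add: u_def dist_norm norm_minus_commute)
      also have "\<dots> < \<rho>" using v \<theta>0 by (simp add: field_simps)
      finally have "u \<in> P" using assms(4) by auto
      then have "(1 - \<theta>) *\<^sub>R x + \<theta> *\<^sub>R u \<in> P" using assms(1,3) \<theta> by (simp add: convexD)
      moreover have "(1 - \<theta>) *\<^sub>R x + \<theta> *\<^sub>R u = v" using \<theta>0 by (simp add: u_def algebra_simps)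
      ultimately show "v \<in> P" by simp
    qed
    then show ?thesis using le assms(2) subset_ball by (meson order_trans)
  qed
qed

lemma curve_length_le_Lipschitz:
  assumes "L-lipschitz_on {a..b} \<gamma>" "a \<le> b"
  shows "curve_length \<gamma> a b \<le> ennreal (L * (b - a))"
  unfolding curve_length_def
proof (rule SUP_least, clarify)
  fix m :: nat and \<tau> :: "nat \<Rightarrow> real"
  assume mono: "mono_on {..m} \<tau>" and im: "\<tau> ` {..m} \<subseteq> {a..b}"
  have L: "L \<ge> 0" using assms(1) by (rule lipschitz_on_nonneg)
  have \<tau>: "\<tau> i \<le> \<tau> (Suc i)" if "i < m" for i using mono_onD[OF mono, of i "Suc i"] that by auto
  have "(\<Sum>i<m. ennreal (dist (\<gamma> (\<tau> i)) (\<gamma> (\<tau> (Suc i))))) \<le> (\<Sum>i<m. ennreal (L * (\<tau> (Suc i) - \<tau> i)))"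
  proof (rule sum_mono)
    fix i assume "i \<in> {..<m}"
    then have i: "i < m" by simp
    then have "\<tau> i \<in> {a..b}" "\<tau> (Suc i) \<in> {a..b}" using image_subset_iff[THEN iffD1, OF im] by (auto simp del: atLeastAtMost_iff)
    from lipschitz_onD[OF assms(1) this] \<tau>[OF i]
    show "ennreal (dist (\<gamma> (\<tau> i)) (\<gamma> (\<tau> (Suc i)))) \<le> ennreal (L * (\<tau> (Suc i) - \<tau> i))"
      by (intro ennreal_leI) (simp add: dist_real_def)
  qed
  also have "\<dots> = ennreal (\<Sum>i<m. L * (\<tau> (Suc i) - \<tau> i))"
    using \<tau> L by (intro sum_ennreal) auto
  also have "(\<Sum>i<m. L * (\<tau> (Suc i) - \<tau> i)) = L * (\<tau> m - \<tau> 0)"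
    by (simp add: sum_distrib_left[symmetric] sum_lessThan_telescope)
  also have "\<dots> \<le> L * (b - a)"
  proof -
    have "\<tau> m \<in> {a..b}" "\<tau> 0 \<in> {a..b}" using im by auto
    then show ?thesis using L by (intro mult_left_mono) auto
  qed
  finally show "(\<Sum>i<m. ennreal (dist (\<gamma> (\<tau> i)) (\<gamma> (\<tau> (Suc i))))) \<le> ennreal (L * (b - a))"
    by (simp add: ennreal_leI)
qed

lemma le_infdist_frontier:
  assumes "open \<Omega>" "frontier \<Omega> \<noteq> {}" "ball x \<rho> \<subseteq> \<Omega>"
  shows "\<rho> \<le> infdist x (frontier \<Omega>)"
proof -
  have "\<rho> \<le> dist x z" if "z \<in> frontier \<Omega>" for z
  proof -
    have "z \<notin> \<Omega>" using that assms(1) by (simp add: frontier_def interior_open)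
    then show ?thesis using assms(3) by (meson linorder_not_le mem_ball subsetD)
  qed
  then show ?thesis using assms(2) by (simp add: infdist_notempty cINF_greatest)
qed

text \<open>The length of a 1-Lipschitz curve is at most its parameter. Rescaling
  \<open>{0..L}\<close> to the unit interval gives the John condition with constant
  \<open>1 / c\<close>, and the curves to \<open>x0\<close> also yield connectedness.\<close>

lemma s_John_domainI:
  fixes \<Omega> :: "'a::euclidean_space set"
  assumes "open \<Omega>" "bounded \<Omega>" "x0 \<in> \<Omega>" "c > 0" "s \<ge> 0"
    and curve: "\<And>x. x \<in> \<Omega> \<Longrightarrow> curve_to s c \<Omega> x0 0 x"
  shows "s_John_domain s \<Omega> x0"
proof -
  have F: "frontier \<Omega> \<noteq> {}"
    using assms by (metis frontier_not_empty not_bounded_UNIV empty_iff)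
  have main: "\<exists>\<gamma>. rectifiable_curve \<gamma> \<and> path_image \<gamma> \<subseteq> \<Omega> \<and>
        pathstart \<gamma> = x \<and> pathfinish \<gamma> = x0 \<and>
        (\<forall>t. 0 < t \<and> t \<le> 1 \<longrightarrow>
           1 / c * infdist (\<gamma> t) (frontier \<Omega>) \<ge> enn2real (curve_length \<gamma> 0 t) powr s)"
    if x: "x \<in> \<Omega>" for x
  proof -
    obtain L \<eta> where L: "L \<ge> 0" "1-lipschitz_on {0..L} \<eta>" "\<eta> 0 = x" "\<eta> L = x0"
      and \<eta>: "\<And>t. t \<in> {0..L} \<Longrightarrow> \<eta> t \<in> \<Omega> \<and> ball (\<eta> t) (c * (0 + t) powr s) \<subseteq> \<Omega>"
      using curve[OF x] unfolding curve_to_def by auto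
    define \<gamma> where "\<gamma> = (\<lambda>t. \<eta> (L * t))"
    have mem: "L * t \<in> {0..L}" if "0 \<le> t" "t \<le> 1" for t using that L(1) by (simp add: mult_left_le)
    have lip: "L-lipschitz_on {0..1} \<gamma>"
    proof (rule lipschitz_onI)
      fix t t' :: real assume "t \<in> {0..1}" "t' \<in> {0..1}"
      then have "dist (\<eta> (L * t)) (\<eta> (L * t')) \<le> 1 * dist (L * t) (L * t')"
        using mem by (intro lipschitz_onD[OF L(2)]) auto
      also have "\<dots> = L * dist t t'" using L(1)
        by (simp add: dist_real_def abs_mult flip: right_diff_distrib)
      finally show "dist (\<gamma> t) (\<gamma> t') \<le> L * dist t t'" by (simp add: \<gamma>_def)
    qed (rule L)
    have len: "curve_length \<gamma> 0 t \<le> ennreal (L * t)" if "0 \<le> t" "t \<le> 1" for t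
      using curve_length_le_Lipschitz[OF lipschitz_on_subset[OF lip], of 0 t] that by simp
    have "rectifiable_curve \<gamma>"
      unfolding rectifiable_curve_def path_def
      using lipschitz_on_continuous_on[OF lip] len[of 1] by (simp add: order_le_less_trans)
    moreover have "path_image \<gamma> \<subseteq> \<Omega>"
      using \<eta> mem by (auto simp: path_image_def \<gamma>_def)
    moreover have "1 / c * infdist (\<gamma> t) (frontier \<Omega>) \<ge> enn2real (curve_length \<gamma> 0 t) powr s"
      if t: "0 < t" "t \<le> 1" for t
    proof -
      have "enn2real (curve_length \<gamma> 0 t) \<le> L * t"
        using len[of t] t L(1) by (intro enn2real_leI) auto
      then have "enn2real (curve_length \<gamma> 0 t) powr s \<le> (L * t) powr s"
        using assms(5) by (intro powr_mono2) auto
      moreover have "c * (L * t) powr s \<le> infdist (\<gamma> t) (frontier \<Omega>)"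
        using \<eta>[OF mem[of t]] t by (intro le_infdist_frontier[OF assms(1) F]) (auto simp: \<gamma>_def)
      ultimately show ?thesis using assms(4) by (simp add: field_simps) 
          (meson mult_left_mono order_trans less_imp_le)
    qed
    moreover have "pathstart \<gamma> = x" "pathfinish \<gamma> = x0"
      using L by (auto simp: \<gamma>_def pathstart_def pathfinish_def)
    ultimately show ?thesis by blast
  qed
  have "path_component \<Omega> x x0" if "x \<in> \<Omega>" for x
    using main[OF that] unfolding path_component_def rectifiable_curve_def by blast
  then have "path_connected \<Omega>"
    unfolding path_connected_component by (meson path_component_sym path_component_trans)
  then have "connected \<Omega>" by (rule path_connected_imp_connected)
  then show ?thesis unfolding s_John_domain_def
    using assms main by (intro conjI exI[of _ "1 / c"]) auto
qed

section \<open>Weak gradients of continuously differentiable functions\<close>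

text \<open>By translation invariance the difference quotients of \<open>f\<close> have integral 0;
  the mean value theorem bounds them by the supremum of \<open>D\<close>, so dominated convergence
  applies.\<close>

lemma integral_directional_derivative_eq_0:
  fixes f D :: "'a::euclidean_space \<Rightarrow> real"
  assumes deriv: "\<And>x t. ((\<lambda>t. f (x + t *\<^sub>R e)) has_real_derivative D (x + t *\<^sub>R e)) (at t)"
    and contf: "continuous_on UNIV f" and contD: "continuous_on UNIV D"
    and K: "compact K" "\<And>x. x \<notin> K \<Longrightarrow> f x = 0" "\<And>x. x \<notin> K \<Longrightarrow> D x = 0"
  shows "(LINT x|lborel. D x) = 0"
proof -
  have "compact (D ` K)" using K(1) contD by (meson compact_continuous_image continuous_on_subset subset_UNIV)
  then obtain M0 where M0: "\<And>x. x \<in> K \<Longrightarrow> norm (D x) \<le> M0"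
    using compact_imp_bounded bounded_iff by (metis imageI)
  define M where "M = max M0 0"
  have M: "\<bar>D x\<bar> \<le> M" for x using M0[of x] K(3)[of x] by (cases "x \<in> K") (auto simp: M_def)
  obtain R where R: "\<And>x. x \<in> K \<Longrightarrow> norm x \<le> R"
    using K(1) compact_imp_bounded bounded_iff by metis
  define h where "h = (\<lambda>m. inverse (real (Suc m)))"
  have h: "0 < h m" "h m \<le> 1" for m by (auto simp: h_def field_simps)
  have hlim: "filterlim h (at 0) sequentially"
    unfolding filterlim_at h_def using LIMSEQ_inverse_real_of_nat by auto
  define q where "q = (\<lambda>m x. (f (h m *\<^sub>R e + x) - f x) / h m)"
  \<comment> \<open>As the increments are at most 1, all difference quotients vanish outside this
    ball.\<close>
  define B where "B = cball (0::'a) (R + norm e)"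
  have [measurable]: "f \<in> borel_measurable borel" "D \<in> borel_measurable borel"
    using contf contD by (auto intro: borel_measurable_continuous_onI)
  have intf: "integrable lborel f"
  proof -
    have "integrable lborel (\<lambda>x. indicator K x *\<^sub>R f x)"
      by (rule borel_integrable_compact[OF K(1)]) (use contf continuous_on_subset in blast)
    moreover have "(\<lambda>x. indicator K x *\<^sub>R f x) = f" using K(2) by (force simp: indicator_def)
    ultimately show ?thesis by simp
  qed
  have trans: "integrable lborel (\<lambda>x. f (c + x))" "(LINT x|lborel. f (c + x)) = (LINT x|lborel. f x)" for c
  proof -
    have "integrable (distr lborel borel ((+) c)) f" using intf by (simp add: lborel_distr_plus)
    then show "integrable lborel (\<lambda>x. f (c + x))" by (subst (asm) integrable_distr_eq) auto
    have "(LINT x|lborel. f x) = (LINT x|distr lborel borel ((+) c). f x)"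
      by (simp add: lborel_distr_plus)
    also have "\<dots> = (LINT x|lborel. f (c + x))" by (subst integral_distr) auto
    finally show "(LINT x|lborel. f (c + x)) = (LINT x|lborel. f x)" by simp
  qed
  have q0: "(LINT x|lborel. q m x) = 0" for m
    unfolding q_def using trans[of "h m *\<^sub>R e"] intf by simp
  have "(\<lambda>m. LINT x|lborel. q m x) \<longlonglongrightarrow> (LINT x|lborel. D x)"
  proof (rule integral_dominated_convergence[where w = "\<lambda>x. M * indicator B x"])
    have "emeasure lborel B < \<infinity>" by (rule emeasure_bounded_finite) (simp add: B_def)
    then show "integrable lborel (\<lambda>x. M * indicator B x)"
      by (intro integrable_mult_right integrable_real_indicator) (simp_all add: B_def)
    show "AE x in lborel. (\<lambda>m. q m x) \<longlonglongrightarrow> D x"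
    proof (rule AE_I2)
      fix x
      have "(\<lambda>t. (f (x + t *\<^sub>R e) - f x) / t) \<midarrow>0\<rightarrow> D x"
        using deriv[of x 0] by (simp add: DERIV_def)
      from filterlim_compose[OF this hlim] show "(\<lambda>m. q m x) \<longlonglongrightarrow> D x"
        by (simp add: q_def add.commute)
    qed
    show "AE x in lborel. norm (q m x) \<le> M * indicator B x" for m
    proof (rule AE_I2)
      fix x
      show "norm (q m x) \<le> M * indicator B x"
      proof (cases "x \<in> B")
        case True
        obtain z where "0 < z" "z < h m" "f (x + h m *\<^sub>R e) - f (x + 0 *\<^sub>R e) = (h m - 0) * D (x + z *\<^sub>R e)"
          using MVT2[of 0 "h m" "\<lambda>t. f (x + t *\<^sub>R e)" "\<lambda>t. D (x + t *\<^sub>R e)"] h deriv by auto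
        then have "q m x = D (x + z *\<^sub>R e)" using h(1)[of m] by (simp add: q_def add.commute)
        then show ?thesis using M True by simp
      next
        case False
        have 1: "x \<notin> K" using False R[of x] by (auto simp: B_def) (use norm_ge_zero[of e] in linarith)
        have "norm x \<le> norm (h m *\<^sub>R e + x) + norm (h m *\<^sub>R e)"
          using norm_triangle_ineq4[of "h m *\<^sub>R e + x" "h m *\<^sub>R e"] by simp
        also have "norm (h m *\<^sub>R e) \<le> norm e" using h(1,2)[of m] by (simp add: mult_left_le_one_le)
        finally have "h m *\<^sub>R e + x \<notin> K" using False R[of "h m *\<^sub>R e + x"] by (auto simp: B_def)
        then show ?thesis using 1 K(2) False by (simp add: q_def)
      qed
    qed
  qed (auto simp: q_def)
  then show ?thesis using q0 by (simp add: LIMSEQ_const_iff)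
qed

lemma continuous_in_Lp_loc:
  fixes f :: "'a::euclidean_space \<Rightarrow> 'b::euclidean_space"
  assumes "open \<Omega>" "continuous_on \<Omega> f" "p > 0"
  shows "f \<in> Lp_loc p \<Omega>"
proof -
  have "set_borel_measurable lebesgue \<Omega> f"
    unfolding set_borel_measurable_def
    using borel_measurable_continuous_on_indicator[OF _ assms(2)] assms(1)
    by (intro measurable_completion) simp
  moreover have "set_integrable lebesgue K (\<lambda>x. norm (f x) powr p)" if K: "compact K" "K \<subseteq> \<Omega>" for K
  proof -
    have "continuous_on K (\<lambda>x. norm (f x) powr p)"
      using assms K by (intro continuous_on_powr' continuous_intros)
        (auto intro: continuous_on_subset)
    from borel_integrable_compact[OF K(1) this]
    show ?thesis unfolding set_integrable_def by (intro integrable_completion[THEN iffD2]) auto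
  qed
  ultimately show ?thesis by (simp add: Lp_loc_def)
qed

text \<open>Integration by parts: the product of \<open>u\<close> and the test function, extended by
  0, is differentiable everywhere with compact support, so its partial derivatives integrate to
  0.\<close>

lemma weak_gradient_C1:
  fixes u :: "real^'n \<Rightarrow> real"
  assumes \<Omega>: "open \<Omega>" and der: "\<And>x. x \<in> \<Omega> \<Longrightarrow> (u has_derivative (\<lambda>v. g x \<bullet> v)) (at x)"
    and contg: "continuous_on \<Omega> g"
  shows "weak_gradient \<Omega> u g"
proof -
  have contu: "continuous_on \<Omega> u"
    by (intro continuous_at_imp_continuous_on ballI has_derivative_continuous[OF der])
  have "(LINT x:\<Omega>|lebesgue. u x * frechet_derivative \<phi> (at x) (axis i 1)) =
        - (LINT x:\<Omega>|lebesgue. g x $ i * \<phi> x)" if \<phi>: "test_function \<Omega> \<phi>" for \<phi> i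
  proof -
    define K where "K = closure {x. \<phi> x \<noteq> 0}"
    define \<phi>' where "\<phi>' = (\<lambda>x. frechet_derivative \<phi> (at x) (axis i 1))"
    have K: "compact K" "K \<subseteq> \<Omega>" using \<phi> by (auto simp: test_function_def K_def)
    have "k_times_cont_diff (Suc 0) \<phi>" using \<phi> unfolding test_function_def by blast
    then have diff: "\<phi> differentiable (at x)" and cont': "continuous_on UNIV \<phi>'" for x
      by (auto simp: \<phi>'_def)
    have D\<phi>: "(\<phi> has_derivative frechet_derivative \<phi> (at x)) (at x)" for x
      using diff frechet_derivative_works by blast
    have cont: "continuous_on UNIV \<phi>"
      by (intro continuous_at_imp_continuous_on ballI has_derivative_continuous[OF D\<phi>])
    have nK: "\<phi> x = 0" if "x \<notin> K" for x
      using that closure_subset[of "{x. \<phi> x \<noteq> 0}"] by (auto simp: K_def)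
    have nKo: "open (- K)" by (simp add: K_def open_closed)
    have nK': "\<phi>' x = 0" if "x \<notin> K" for x
    proof -
      have "((\<lambda>_. 0) has_derivative (\<lambda>_. 0)) (at x)" by simp
      then have "(\<phi> has_derivative (\<lambda>_. 0)) (at x)"
        by (rule has_derivative_transform_within_open[OF _ nKo]) (use that nK in auto)
      then have "frechet_derivative \<phi> (at x) = (\<lambda>_. 0)" by (metis frechet_derivative_at)
      then show ?thesis by (simp add: \<phi>'_def)
    qed
    \<comment> \<open>Continuity is clear on \<open>\<Omega>\<close>, and on \<open>- K\<close> the
      function is 0; these two open sets cover the space.\<close>
    have cutoff: "continuous_on UNIV (\<lambda>x. indicator \<Omega> x *\<^sub>R (a x * \<psi> x))"
      "integrable lborel (\<lambda>x. indicator \<Omega> x *\<^sub>R (a x * \<psi> x))"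
      if a: "continuous_on \<Omega> a" and \<psi>: "continuous_on UNIV \<psi>" and z: "\<And>x. x \<notin> K \<Longrightarrow> \<psi> x = 0"
      for a \<psi> :: "real^'n \<Rightarrow> real"
    proof -
      let ?f = "\<lambda>x. indicator \<Omega> x *\<^sub>R (a x * \<psi> x)"
      have "continuous_on \<Omega> (\<lambda>x. a x * \<psi> x)"
        using a \<psi> continuous_on_subset by (intro continuous_on_mult) blast+
      then have 1: "continuous_on \<Omega> ?f" by (rule continuous_on_eq) auto
      have "continuous_on (-K) (\<lambda>x. 0::real)" by simp
      then have 2: "continuous_on (-K) ?f" by (rule continuous_on_eq) (use z in auto)
      have U: "\<Omega> \<union> - K = UNIV" using K by auto
      show c: "continuous_on UNIV ?f"
        using continuous_on_open_Un[OF \<Omega> nKo 1 2] by (simp only: U)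
      have "integrable lborel (\<lambda>x. indicator K x *\<^sub>R ?f x)"
        by (rule borel_integrable_compact[OF K(1)]) (use c continuous_on_subset in blast)
      moreover have "(\<lambda>x. indicator K x *\<^sub>R ?f x) = ?f" using z by (force simp: indicator_def)
      ultimately show "integrable lborel ?f" by simp
    qed
    have gi: "continuous_on \<Omega> (\<lambda>x. g x $ i)" using contg by (intro continuous_intros)
    define D where "D = (\<lambda>x. indicator \<Omega> x *\<^sub>R (u x * \<phi>' x) + indicator \<Omega> x *\<^sub>R (g x $ i * \<phi> x))"
    define f where "f = (\<lambda>x. indicator \<Omega> x *\<^sub>R (u x * \<phi> x))"
    note c1 = cutoff[OF contu cont' nK'] and c2 = cutoff[OF gi cont nK]
    have Df: "\<exists>f'. (f has_derivative f') (at x) \<and> f' (axis i 1) = D x" for x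
    proof (cases "x \<in> \<Omega>")
      case True
      have "((\<lambda>x. u x * \<phi> x) has_derivative
          (\<lambda>v. u x * frechet_derivative \<phi> (at x) v + (g x \<bullet> v) * \<phi> x)) (at x)"
        by (intro has_derivative_mult der True D\<phi>)
      then have "(f has_derivative
          (\<lambda>v. u x * frechet_derivative \<phi> (at x) v + (g x \<bullet> v) * \<phi> x)) (at x)"
        by (rule has_derivative_transform_within_open[OF _ \<Omega> True]) (simp add: f_def)
      moreover have "u x * frechet_derivative \<phi> (at x) (axis i 1) + (g x \<bullet> axis i 1) * \<phi> x = D x"
        using True by (simp add: D_def \<phi>'_def inner_axis)
      ultimately show ?thesis by blast
    next
      case False
      then have "x \<in> - K" using K by auto
      have "((\<lambda>_. 0) has_derivative (\<lambda>_. 0)) (at x)" by simp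
      then have "(f has_derivative (\<lambda>_. 0)) (at x)"
        by (rule has_derivative_transform_within_open[OF _ nKo \<open>x \<in> - K\<close>]) (simp add: f_def nK)
      moreover have "0 = D x" using False by (simp add: D_def)
      ultimately show ?thesis by blast
    qed
    have "(LINT x|lborel. D x) = 0"
    proof (rule integral_directional_derivative_eq_0[where f = f and e = "axis i 1" and K = K])
      show "continuous_on UNIV f" unfolding f_def by (rule cutoff(1)[OF contu cont nK])
      show "continuous_on UNIV D" unfolding D_def by (intro continuous_on_add c1 c2)
      show "D x = 0" "f x = 0" if "x \<notin> K" for x using that nK nK' by (auto simp: D_def f_def)
      fix x :: "real^'n" and t :: real
      obtain f' where f': "(f has_derivative f') (at (x + t *\<^sub>R axis i 1))" "f' (axis i 1) = D (x + t *\<^sub>R axis i 1)"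
        using Df by blast
      have "((\<lambda>t. x + t *\<^sub>R axis i 1) has_derivative (\<lambda>h. h *\<^sub>R axis i 1)) (at t)"
        by (auto intro!: derivative_eq_intros)
      from has_derivative_compose[OF this f'(1)]
      have "((\<lambda>t. f (x + t *\<^sub>R axis i 1)) has_derivative (\<lambda>h. f' (h *\<^sub>R axis i 1))) (at t)" .
      moreover have "f' (h *\<^sub>R axis i 1) = D (x + t *\<^sub>R axis i 1) * h" for h
        using linear_scale[OF has_derivative_linear[OF f'(1)]] f'(2) by simp
      ultimately show "((\<lambda>t. f (x + t *\<^sub>R axis i 1)) has_real_derivative D (x + t *\<^sub>R axis i 1)) (at t)"
        by (simp add: has_field_derivative_def)
    qed (rule K)
    then have "(LINT x|lborel. indicator \<Omega> x *\<^sub>R (u x * \<phi>' x)) = - (LINT x|lborel. indicator \<Omega> x *\<^sub>R (g x $ i * \<phi> x))"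
      unfolding D_def using c1(2) c2(2) by simp
    moreover have "(LINT x|lebesgue. indicator \<Omega> x *\<^sub>R (u x * \<phi>' x)) = (LINT x|lborel. indicator \<Omega> x *\<^sub>R (u x * \<phi>' x))"
      "(LINT x|lebesgue. indicator \<Omega> x *\<^sub>R (g x $ i * \<phi> x)) = (LINT x|lborel. indicator \<Omega> x *\<^sub>R (g x $ i * \<phi> x))"
      using c1(2) c2(2) by (intro integral_completion borel_measurable_integrable; simp)+
    ultimately show ?thesis by (simp add: set_lebesgue_integral_def \<phi>'_def)
  qed
  then show ?thesis unfolding weak_gradient_def
    using continuous_in_Lp_loc[OF \<Omega> contu] continuous_in_Lp_loc[OF \<Omega> contg] by simp
qed

text \<open>A continuously differentiable \<open>u\<close> is itself a competitor, and its energy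
  lives on \<open>S\<close>, where the gradient is at most \<open>C\<close>.\<close>

lemma Capacity_le_C1:
  fixes u :: "real^'n \<Rightarrow> real"
  assumes \<Omega>: "open \<Omega>" and der: "\<And>x. x \<in> \<Omega> \<Longrightarrow> (u has_derivative (\<lambda>v. g x \<bullet> v)) (at x)"
    and contg: "continuous_on \<Omega> g" and p: "1 \<le> p"
    and bound: "\<And>x. x \<in> \<Omega> \<Longrightarrow> x \<in> S \<Longrightarrow> norm (g x) \<le> C" "\<And>x. x \<in> \<Omega> \<Longrightarrow> x \<notin> S \<Longrightarrow> g x = 0"
    and S: "S \<in> sets borel" 
    and E: "\<And>x. x \<in> E \<Longrightarrow> u x \<le> 0" and F: "\<And>x. x \<in> F \<Longrightarrow> u x \<ge> 1"
  shows "Capacity p E F \<Omega> \<le> ennreal (C powr p) * emeasure lborel S"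
proof -
  have contu: "continuous_on \<Omega> u"
    by (intro continuous_at_imp_continuous_on ballI has_derivative_continuous[OF der])
  have w: "weak_gradient \<Omega> u g" by (rule weak_gradient_C1[OF \<Omega> der contg])
  have "u \<in> W1p_loc p \<Omega>" unfolding W1p_loc_def
    using w continuous_in_Lp_loc[OF \<Omega> contu] continuous_in_Lp_loc[OF \<Omega> contg] p by auto
  then have "Capacity p E F \<Omega> \<le> (\<integral>\<^sup>+x\<in>\<Omega>. ennreal (norm (g x) powr p) \<partial>lebesgue)"
    unfolding Capacity_def using contu w E F
    by (intro INF_lower2[of "(u, g)"]) auto
  also have "\<dots> \<le> (\<integral>\<^sup>+x. ennreal (C powr p) * indicator S x \<partial>lebesgue)"
  proof (rule nn_integral_mono)
    fix x
    show "ennreal (norm (g x) powr p) * indicator \<Omega> x \<le> ennreal (C powr p) * indicator S x"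
      using bound[of x] p by (auto simp: indicator_def intro!: ennreal_leI powr_mono2)
  qed
  also have "\<dots> = ennreal (C powr p) * emeasure lborel S"
    using S by (subst nn_integral_cmult_indicator) auto
  finally show ?thesis .
qed

section \<open>The folded tree\<close>

lemma norm_le_card_mult:
  fixes z :: "real^'n"
  assumes "\<And>a. \<bar>z $ a\<bar> \<le> M"
  shows "norm z \<le> real CARD('n) * M"
proof -
  have "norm z \<le> (\<Sum>a\<in>UNIV. \<bar>z $ a\<bar>)" by (rule norm_le_l1_cart)
  also have "\<dots> \<le> (\<Sum>a\<in>(UNIV::'n set). M)" by (rule sum_mono) (rule assms)
  finally show ?thesis by simp
qed

lemma open_abs_box: "open {z::real^'n. \<forall>a. \<bar>z $ a\<bar> < c a}"
proof -
  have "{z::real^'n. \<forall>a. \<bar>z $ a\<bar> < c a} = (\<Inter>a. {z. \<bar>z $ a\<bar> < c a})" by blast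
  moreover have "open {z::real^'n. \<bar>z $ a\<bar> < c a}" for a
    by (intro open_Collect_less continuous_intros)
  ultimately show ?thesis by (simp add: open_INT)
qed

lemma convex_abs_box: "convex {z::real^'n. \<forall>a. \<bar>z $ a\<bar> < c a}"
proof (rule convexI, clarify)
  fix x y :: "real^'n" and u v :: real and a
  assume c: "\<forall>a. \<bar>x $ a\<bar> < c a" "\<forall>a. \<bar>y $ a\<bar> < c a" and u: "0 \<le> u" "0 \<le> v" "u + v = 1"
  have "x $ a \<in> ball 0 (c a)" "y $ a \<in> ball 0 (c a)" using c by simp_all
  then have "u *\<^sub>R (x $ a) + v *\<^sub>R (y $ a) \<in> ball 0 (c a)" using u by (intro convexD convex_ball)
  then show "\<bar>(u *\<^sub>R x + v *\<^sub>R y) $ a\<bar> < c a" by simp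
qed

lemma norm_axis_eq: "norm (axis i c :: real^'n) = \<bar>c\<bar>"
proof -
  have "axis i c = c *\<^sub>R (axis i 1 :: real^'n)" by (simp add: vec_eq_iff axis_def)
  then show ?thesis by simp
qed

text \<open>\<open>b k a\<close> is the half-extent along \<open>a\<close> of a box around the subtree below a node of level \<open>k\<close>, and
  \<open>2 * g k\<close> bounds from below the gap between the boxes of its two children.\<close>

locale folding_tree =
  fixes \<alpha> :: "nat \<Rightarrow> 'n::finite" and b :: "nat \<Rightarrow> 'n \<Rightarrow> real" and h g r w :: "nat \<Rightarrow> real"
  assumes axis_Suc: "\<alpha> (Suc k) \<noteq> \<alpha> k"
    and b_other: "a \<noteq> \<alpha> k \<Longrightarrow> b (Suc k) a = b k a"
    and b_axis: "b (Suc k) (\<alpha> k) + h k = b k (\<alpha> k)"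
    and gap: "g k \<le> h k - b (Suc k) (\<alpha> k)"
    and r_gap: "2 * r k \<le> g k"
    and r_b: "r k \<le> b k a"
    and w_pos: "0 < w k" and w_r: "w k \<le> r k" "w k \<le> r (Suc k)"
begin

lemma r_pos: "0 < r k" using w_pos[of k] w_r(1)[of k] by linarith
lemma b_pos: "0 < b k a" using r_pos[of k] r_b[of k a] by linarith
lemma r_less_g: "r k < g k" using r_pos[of k] r_gap[of k] by linarith
lemma b_less_h: "b (Suc k) (\<alpha> k) < h k" using gap[of k] r_less_g[of k] r_pos[of k] by linarith
lemma h_pos: "0 < h k" using b_less_h[of k] b_pos[of "Suc k" "\<alpha> k"] by linarith
lemma r_less_h: "r k < h k" using gap[of k] b_pos[of "Suc k" "\<alpha> k"] r_less_g[of k] by linarith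

section \<open>Folding maps and the pieces of the domain\<close>

text \<open>Folding acts on each coordinate separately, so creases, branches and derivatives can be
  studied for functions of one real variable.\<close>

fun \<psi> :: "nat \<Rightarrow> 'n \<Rightarrow> real \<Rightarrow> real" where
  "\<psi> 0 a t = t"
| "\<psi> (Suc k) a t = (if a = \<alpha> k then \<bar>\<psi> k a t\<bar> - h k else \<psi> k a t)"

definition F :: "nat \<Rightarrow> real^'n \<Rightarrow> real^'n" where "F k x = (\<chi> a. \<psi> k a (x $ a))"

definition fld :: "nat \<Rightarrow> real^'n \<Rightarrow> real^'n" where
  "fld k z = (\<chi> a. if a = \<alpha> k then \<bar>z $ a\<bar> - h k else z $ a)"

definition Box :: "nat \<Rightarrow> (real^'n) set" where "Box k = {z. \<forall>a. \<bar>z $ a\<bar> \<le> b k a}"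
definition room :: "nat \<Rightarrow> (real^'n) set" where "room k = {z. \<forall>a. \<bar>z $ a\<bar> < r k}"
text \<open>The passage overshoots the child nodes by \<open>w k\<close>, so it overlaps their rooms
  and contains the balls of radius \<open>w k\<close> about its two end nodes.\<close>

definition passage :: "nat \<Rightarrow> (real^'n) set" where
  "passage k = {z. \<forall>a. \<bar>z $ a\<bar> < (if a = \<alpha> k then h k + w k else w k)}"
text \<open>Taking the preimage under \<open>F k\<close> produces the copies at all nodes of level
  \<open>k\<close> at once.\<close>

definition piece :: "nat \<Rightarrow> (real^'n) set" where "piece k = F k -` (room k \<union> passage k)"
definition Dom :: "(real^'n) set" where "Dom = (\<Union>k. piece k)"

lemma F_nth [simp]: "F k x $ a = \<psi> k a (x $ a)" by (simp add: F_def)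
lemma F_0 [simp]: "F 0 x = x" by (simp add: F_def)

lemma F_Suc: "F (Suc k) x = fld k (F k x)" by (simp add: fld_def vec_eq_iff)

lemma continuous_\<psi>: "continuous_on UNIV (\<psi> k a)"
proof (induction k)
  case 0
  have "\<psi> 0 a = (\<lambda>t. t)" by (rule ext) simp
  then show ?case by simp
next
  case (Suc k)
  have "\<psi> (Suc k) a = (\<lambda>t. if a = \<alpha> k then \<bar>\<psi> k a t\<bar> - h k else \<psi> k a t)" by (rule ext) simp
  then show ?case using Suc by (cases "a = \<alpha> k") (auto intro!: continuous_intros)
qed

lemma continuous_F: "continuous_on UNIV (F k)"
  unfolding F_def
  by (intro continuous_on_vec_lambda continuous_on_compose2[OF continuous_\<psi>] continuous_intros) auto

lemma room_subset_Box: "room k \<subseteq> Box k"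
  using r_b by (auto simp: room_def Box_def) (meson less_eq_real_def order_less_le_trans)

lemma passageD: "z \<in> passage k \<Longrightarrow> \<bar>z $ a\<bar> < (if a = \<alpha> k then h k + w k else w k)"
  by (simp add: passage_def)

lemma passage_subset_Box: "passage k \<subseteq> Box k"
proof
  fix z assume z: "z \<in> passage k"
  note * = passageD[OF z]
  have "\<bar>z $ a\<bar> \<le> b k a" for a
  proof (cases "a = \<alpha> k")
    case True
    then have "\<bar>z $ a\<bar> < h k + w k" using *[of a] by simp
    then show ?thesis using b_axis[of k] w_r(2)[of k] r_b[of "Suc k" "\<alpha> k"] True by simp
  next
    case False
    then have "\<bar>z $ a\<bar> < w k" using *[of a] by simp
    then show ?thesis using w_r(1)[of k] r_b[of k a] by simp
  qed
  then show "z \<in> Box k" by (simp add: Box_def)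
qed

lemma F_piece_Box: "x \<in> piece k \<Longrightarrow> F k x \<in> Box k"
  using room_subset_Box passage_subset_Box by (auto simp: piece_def)

text \<open>Unfolding moves the child box by \<open>h k\<close> to either side; there it still fits
  into the parent box and keeps the distance \<open>g k\<close> from the crease.\<close>

lemma Box_fld:
  assumes "fld k z \<in> Box (Suc k)"
  shows "z \<in> Box k" "g k \<le> \<bar>z $ \<alpha> k\<bar>"
proof -
  have *: "\<bar>fld k z $ a\<bar> \<le> b (Suc k) a" for a using assms by (simp add: Box_def)
  have "\<bar>z $ a\<bar> \<le> b k a" for a
    using *[of a] b_axis[of k] b_other[of a k] by (cases "a = \<alpha> k") (auto simp: fld_def)
  then show "z \<in> Box k" by (simp add: Box_def)
  show "g k \<le> \<bar>z $ \<alpha> k\<bar>" using *[of "\<alpha> k"] gap[of k] by (simp add: fld_def)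
qed

lemma Box_Suc: 
  assumes "F (Suc k) x \<in> Box (Suc k)"
  shows "F k x \<in> Box k" "g k \<le> \<bar>\<psi> k (\<alpha> k) (x $ \<alpha> k)\<bar>"
  using Box_fld[of k "F k x"] assms by (simp_all add: F_Suc)

lemma Box_mono: "F k x \<in> Box k \<Longrightarrow> i \<le> k \<Longrightarrow> F i x \<in> Box i"
proof (induction k)
  case (Suc k)
  then show ?case using Box_Suc(1) by (cases "i = Suc k") auto
qed simp

lemma room_not_Box: "F k x \<in> room k \<Longrightarrow> F (Suc k) x \<notin> Box (Suc k)"
  using Box_Suc(2)[of k x] r_less_g[of k] by (force simp: room_def dest: spec[of _ "\<alpha> k"])

text \<open>A passage does enter the boxes of the children, but not those of the grandchildren:
  these stay \<open>g (Suc k)\<close> away from the crease of the next axis, while the passage has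
  only half-width \<open>w k\<close> in that direction.\<close>

lemma passage_not_Box: "F k x \<in> passage k \<Longrightarrow> F (Suc (Suc k)) x \<notin> Box (Suc (Suc k))"
proof
  assume 1: "F k x \<in> passage k" and "F (Suc (Suc k)) x \<in> Box (Suc (Suc k))"
  from Box_Suc(2)[OF this(2)] have "g (Suc k) \<le> \<bar>\<psi> k (\<alpha> (Suc k)) (x $ \<alpha> (Suc k))\<bar>"
    using axis_Suc[of k] by simp
  moreover have "\<bar>\<psi> k (\<alpha> (Suc k)) (x $ \<alpha> (Suc k))\<bar> < w k"
    using 1 axis_Suc[of k] passageD[of "F k x" k "\<alpha> (Suc k)"] by simp
  ultimately show False using w_r(2)[of k] r_less_g[of "Suc k"] by linarith
qed

lemma open_room: "open (room k)"
  unfolding room_def by (rule open_abs_box)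

lemma open_passage: "open (passage k)"
  unfolding passage_def by (rule open_abs_box)

lemma open_piece: "open (piece k)"
  unfolding piece_def using continuous_F open_room open_passage by (intro open_vimage) auto

lemma open_Dom: "open Dom" unfolding Dom_def using open_piece by auto

lemma Dom_subset_Box: "Dom \<subseteq> Box 0"
  using F_piece_Box Box_mono[of _ _ 0] unfolding Dom_def by fastforce

lemma bounded_F_Box: "bounded (F k -` Box k)"
proof -
  have "norm x \<le> real CARD('n) * Max (range (b 0))" if "F k x \<in> Box k" for x
  proof (rule norm_le_card_mult)
    fix a
    have "\<bar>x $ a\<bar> \<le> b 0 a" using Box_mono[OF that, of 0] by (simp add: Box_def)
    also have "\<dots> \<le> Max (range (b 0))" by (rule Max_ge) auto
    finally show "\<bar>x $ a\<bar> \<le> Max (range (b 0))" .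
  qed
  then show ?thesis unfolding bounded_iff by auto
qed

lemma bounded_Dom: "bounded Dom"
  using bounded_F_Box[of 0] Dom_subset_Box by (rule_tac bounded_subset[of "Box 0"]) (auto simp: vimage_def)

lemma zero_in_Dom: "0 \<in> Dom"
proof -
  have "0 \<in> piece 0" using r_pos by (simp add: piece_def room_def)
  then show ?thesis by (auto simp: Dom_def)
qed

text \<open>Every branch of the inverse of a folding map is an isometry as long as one stays in the box of
  the node, where no further crease is met.\<close>

lemma \<psi>_lift: "\<exists>\<sigma> d. (\<sigma> = 1 \<or> \<sigma> = -1) \<and> (\<forall>\<zeta>. \<bar>\<zeta>\<bar> \<le> b k a \<longrightarrow> \<psi> k a (\<sigma> * \<zeta> + d) = \<zeta>) \<and> \<sigma> * \<psi> k a t + d = t"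
proof (induction k)
  case 0
  show ?case by (rule exI[of _ 1], rule exI[of _ 0]) simp
next
  case (Suc k)
  then obtain \<sigma> d where \<sigma>: "\<sigma> = 1 \<or> \<sigma> = -1" 
    and l: "\<And>\<zeta>. \<bar>\<zeta>\<bar> \<le> b k a \<Longrightarrow> \<psi> k a (\<sigma> * \<zeta> + d) = \<zeta>" and e: "\<sigma> * \<psi> k a t + d = t" by blast
  show ?case
  proof (cases "a = \<alpha> k")
    case False
    then show ?thesis using \<sigma> l e b_other[OF False] by (intro exI[of _ \<sigma>] exI[of _ d]) auto
  next
    case True
    \<comment> \<open>\<open>\<epsilon>\<close> is the side of the new crease on which
      \<open>t\<close> lies; the new branch is the old one evaluated at
      \<open>\<epsilon> * (\<zeta> + h k)\<close>.\<close>
    define \<epsilon> :: real where "\<epsilon> = (if \<psi> k a t \<ge> 0 then 1 else -1)"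
    have \<epsilon>: "\<epsilon> = 1 \<or> \<epsilon> = -1" "\<epsilon> * \<bar>\<psi> k a t\<bar> = \<psi> k a t" by (auto simp: \<epsilon>_def)
    have "\<psi> (Suc k) a (\<sigma> * \<epsilon> * \<zeta> + (d + \<sigma> * \<epsilon> * h k)) = \<zeta>" if z: "\<bar>\<zeta>\<bar> \<le> b (Suc k) a" for \<zeta>
    proof -
      have pos: "\<zeta> + h k \<ge> 0" using z b_less_h[of k] True by simp
      have "\<bar>\<epsilon> * (\<zeta> + h k)\<bar> \<le> b k a" using z b_axis[of k] pos True \<epsilon>(1) by (auto simp: abs_mult)
      from l[OF this] have "\<psi> k a (\<sigma> * \<epsilon> * \<zeta> + (d + \<sigma> * \<epsilon> * h k)) = \<epsilon> * (\<zeta> + h k)"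
        by (simp add: algebra_simps)
      then show ?thesis using True pos \<epsilon>(1) by (auto simp: abs_mult)
    qed
    moreover have "\<sigma> * \<epsilon> * \<psi> (Suc k) a t + (d + \<sigma> * \<epsilon> * h k) = t"
    proof -
      have "\<sigma> * \<epsilon> * \<psi> (Suc k) a t + (d + \<sigma> * \<epsilon> * h k) = \<sigma> * (\<epsilon> * \<bar>\<psi> k a t\<bar>) + d"
        using True by (simp add: algebra_simps)
      also have "\<dots> = t" using \<epsilon>(2) e by simp
      finally show ?thesis .
    qed
    moreover have "\<sigma> * \<epsilon> = 1 \<or> \<sigma> * \<epsilon> = -1" using \<sigma> \<epsilon> by auto
    ultimately show ?thesis by blast
  qed
qed

text \<open>The coordinate branches through \<open>x\<close> are combined into one affine isometry,
  which carries segments and balls from the frame of the node back to the domain.\<close>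

lemma ex_lift:
  obtains G where "G (F k x) = x" "\<And>z. z \<in> Box k \<Longrightarrow> F k (G z) = z"
    "\<And>y z. dist (G y) (G z) = dist y z" "surj G"
    "\<And>y z t. G ((1 - t) *\<^sub>R y + t *\<^sub>R z) = (1 - t) *\<^sub>R G y + t *\<^sub>R G z"
proof -
  have "\<forall>a. \<exists>\<sigma> d. (\<sigma> = 1 \<or> \<sigma> = -1) \<and> (\<forall>\<zeta>. \<bar>\<zeta>\<bar> \<le> b k a \<longrightarrow> \<psi> k a (\<sigma> * \<zeta> + d) = \<zeta>) \<and> \<sigma> * \<psi> k a (x $ a) + d = x $ a"
    using \<psi>_lift by blast
  then obtain \<sigma> d where \<sigma>: "\<And>a. \<sigma> a = (1::real) \<or> \<sigma> a = -1"
    and l: "\<And>a \<zeta>. \<bar>\<zeta>\<bar> \<le> b k a \<Longrightarrow> \<psi> k a (\<sigma> a * \<zeta> + d a) = \<zeta>"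
    and e: "\<And>a. \<sigma> a * \<psi> k a (x $ a) + d a = x $ a" by metis
  define G :: "real^'n \<Rightarrow> real^'n" where "G = (\<lambda>z. \<chi> a. \<sigma> a * z $ a + d a)"
  have \<sigma>2: "\<sigma> a * \<sigma> a = 1" "\<bar>\<sigma> a\<bar> = 1" for a using \<sigma>[of a] by auto
  have "dist (G y) (G z) = dist y z" for y z
  proof -
    have "dist (G y $ a) (G z $ a) = dist (y $ a) (z $ a)" for a
      using \<sigma>2[of a] by (simp add: G_def dist_real_def flip: right_diff_distrib) (simp add: abs_mult)
    then show ?thesis by (simp add: dist_vec_def)
  qed
  moreover have "surj G"
  proof (rule surjI)
    fix y show "G (\<chi> a. \<sigma> a * (y $ a - d a)) = y"
      using \<sigma>2 by (simp add: G_def vec_eq_iff mult.assoc[symmetric])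
  qed
  moreover have "G ((1 - t) *\<^sub>R y + t *\<^sub>R z) = (1 - t) *\<^sub>R G y + t *\<^sub>R G z" for y z t
    by (simp add: G_def vec_eq_iff algebra_simps)
  moreover have "G (F k x) = x" using e by (simp add: G_def vec_eq_iff)
  moreover have "F k (G z) = z" if "z \<in> Box k" for z
    using that l by (simp add: G_def vec_eq_iff Box_def)
  ultimately show ?thesis using that by blast
qed

lemma convex_room: "convex (room k)"
  unfolding room_def by (rule convex_abs_box)

lemma convex_passage: "convex (passage k)"
  unfolding passage_def by (rule convex_abs_box)

lemma DomI: "F k x \<in> room k \<union> passage k \<Longrightarrow> x \<in> Dom"
  unfolding Dom_def piece_def by blast

section \<open>The John condition for the tree\<close>

text \<open>\<open>A k\<close> bounds the length travelled until a node of level \<open>k\<close> is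
  reached: \<open>A1\<close> covers the straight first leg, \<open>A2\<close> each passage climbed,
  and \<open>A3\<close> says that the passages are wide enough for that length.\<close>

lemma s_John_domain_Dom:
  fixes A :: "nat \<Rightarrow> real"
  assumes s: "1 \<le> s" and c: "0 < c"
    and A1: "\<And>k. real CARD('n) * (h k + w k) \<le> A k"
    and A2: "\<And>k. A (Suc k) + h k \<le> A k"
    and A3: "\<And>k. c * A k powr s \<le> w k"
  shows "s_John_domain s Dom 0"
proof (rule s_John_domainI[OF open_Dom bounded_Dom zero_in_Dom c])
  show "s \<ge> 0" using s by simp
  have A0: "0 \<le> A k" for k
    using A1[of k] h_pos[of k] w_pos[of k] by (smt (verit) mult_nonneg_nonneg of_nat_0_le_iff)
  \<comment> \<open>A surjective isometry maps balls onto balls, so membership in \<open>Dom\<close>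
    can be checked in the frame of the node.\<close>
  have ball_G: "ball (G z) \<rho> \<subseteq> Dom" 
    if "ball z \<rho> \<subseteq> room k \<union> passage k" "\<And>z. z \<in> Box k \<Longrightarrow> F k (G z) = z"
      "\<And>y z. dist (G y) (G z) = dist y z" "surj G" for G z \<rho> k
  proof
    fix v assume v: "v \<in> ball (G z) \<rho>"
    obtain y where y: "v = G y" using \<open>surj G\<close> by (metis surjD)
    then have "y \<in> ball z \<rho>" using v that(3) by simp
    then have 1: "y \<in> room k \<union> passage k" using that(1) by blast
    then have "F k (G y) = y" using room_subset_Box passage_subset_Box that(2) by blast
    then show "v \<in> Dom" using 1 y DomI[of k v] by simp
  qed
  have ball_room: "ball 0 (w k) \<subseteq> room k" for k
  proof
    fix z :: "real^'n" assume "z \<in> ball 0 (w k)"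
    then show "z \<in> room k" using component_le_norm_cart[of z] w_r(1)[of k] 
      by (auto simp: room_def) (meson less_le_trans le_less_trans)
  qed
  have node: "curve_to s c Dom 0 (A k) y" if "F k y = 0" for k y
    using that
  proof (induction k arbitrary: y)
    case 0
    then have "y = 0" by simp
    have "ball 0 (c * A 0 powr s) \<subseteq> ball 0 (w 0)" by (rule subset_ball) (rule A3)
    also have "\<dots> \<subseteq> Dom" using ball_room[of 0] DomI[of 0] by auto
    finally show ?case using curve_to_refl[OF zero_in_Dom] \<open>y = 0\<close> by blast
  next
    case (Suc k)
    obtain G where G: "G (F k y) = y" "\<And>z. z \<in> Box k \<Longrightarrow> F k (G z) = z"
      "\<And>y z. dist (G y) (G z) = dist y z" "surj G"
      "\<And>y z t. G ((1 - t) *\<^sub>R y + t *\<^sub>R z) = (1 - t) *\<^sub>R G y + t *\<^sub>R G z"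
      using ex_lift by metis
    define v where "v = F k y"
    have v: "\<psi> (Suc k) a (y $ a) = 0" for a
      using arg_cong[OF Suc.prems, of "\<lambda>z. z $ a"] by (simp del: \<psi>.simps)
    have v1: "\<bar>v $ \<alpha> k\<bar> = h k" using v[of "\<alpha> k"] by (simp add: v_def)
    have v2: "v $ a = 0" if "a \<noteq> \<alpha> k" for a using v[of a] that by (simp add: v_def)
    \<comment> \<open>Only the last fold separates the child from its parent, so \<open>v\<close>
      lies on the axis \<open>\<alpha> k\<close> at distance \<open>h k\<close>.\<close>
    have "v = axis (\<alpha> k) (v $ \<alpha> k)" using v2 by (simp add: vec_eq_iff axis_def)
    then have "norm v = norm (axis (\<alpha> k) (v $ \<alpha> k) :: real^'n)" by (rule arg_cong[where f = norm])
    then have nv: "norm v = h k" by (simp only: norm_axis_eq v1)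
    have zBox: "0 \<in> Box k" using b_pos by (simp add: Box_def less_imp_le)
    have d: "dist y (G 0) = h k" using G(3)[of v 0] G(1) nv by (simp add: v_def)
    show ?case
    proof (rule curve_to_segment[where y = "G 0" and \<rho> = "w k"])
      fix u assume "u \<in> closed_segment y (G 0)"
      then obtain t where t: "0 \<le> t" "t \<le> 1" "u = (1 - t) *\<^sub>R y + t *\<^sub>R G 0" by (auto simp: in_segment)
      then have u: "u = G ((1 - t) *\<^sub>R v)" using G(1) G(5)[of t v 0] by (simp add: v_def)
      have "ball ((1 - t) *\<^sub>R v) (w k) \<subseteq> passage k"
      proof
        fix z assume z: "z \<in> ball ((1 - t) *\<^sub>R v) (w k)"
        have "\<bar>z $ a\<bar> < (if a = \<alpha> k then h k + w k else w k)" for a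
        proof -
          have "\<bar>z $ a - (1 - t) * v $ a\<bar> < w k"
            using component_le_norm_cart[of "z - (1 - t) *\<^sub>R v" a] z 
            by (simp add: dist_norm norm_minus_commute)
          moreover have "\<bar>(1 - t) * v $ a\<bar> \<le> (if a = \<alpha> k then h k else 0)"
            using v1 v2[of a] t h_pos[of k] by (auto simp: abs_mult mult_left_le_one_le)
          ultimately show ?thesis by (auto split: if_splits)
        qed
        then show "z \<in> passage k" by (simp add: passage_def)
      qed
      then show "ball u (w k) \<subseteq> Dom" unfolding u using ball_G[OF _ G(2-4)] by blast
    next
      have "c * (A (Suc k) + h k) powr s \<le> c * A k powr s"
        using A2[of k] A0[of "Suc k"] h_pos[of k] s c by (intro mult_left_mono powr_mono2) auto
      then show "c * (A (Suc k) + dist y (G 0)) powr s \<le> w k" using A3[of k] d by simp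
      have "curve_to s c Dom 0 (A k) (G 0)" by (rule Suc.IH) (rule G(2)[OF zBox])
      then show "curve_to s c Dom 0 (A (Suc k) + dist y (G 0)) (G 0)"
        using A2[of k] A0[of "Suc k"] s c d h_pos[of k] by (elim curve_to_mono) auto
    qed (use w_pos c s A0 in auto)
  qed
  fix x assume "x \<in> Dom"
  then obtain k where "F k x \<in> room k \<union> passage k" by (auto simp: Dom_def piece_def)
  moreover have ball_passage: "ball 0 (w k) \<subseteq> passage k"
  proof
    fix z :: "real^'n" assume "z \<in> ball 0 (w k)"
    then have "\<bar>z $ a\<bar> < (if a = \<alpha> k then h k + w k else w k)" for a
      using component_le_norm_cart[of z a] h_pos[of k] by (cases "a = \<alpha> k") auto
    then show "z \<in> passage k" by (simp add: passage_def)
  qed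
  \<comment> \<open>Rooms and passages share all that is needed, convexity and a ball of radius
    \<open>w k\<close> about the node, so one argument serves both.\<close>
  ultimately obtain P where P: "F k x \<in> P" "convex P" "P \<subseteq> room k \<union> passage k" "ball 0 (w k) \<subseteq> P"
    using convex_room convex_passage ball_room by blast
  obtain G where G: "G (F k x) = x" "\<And>z. z \<in> Box k \<Longrightarrow> F k (G z) = z"
    "\<And>y z. dist (G y) (G z) = dist y z" "surj G"
    "\<And>y z t. G ((1 - t) *\<^sub>R y + t *\<^sub>R z) = (1 - t) *\<^sub>R G y + t *\<^sub>R G z"
    using ex_lift by metis
  have PB: "P \<subseteq> Box k" using P(3) room_subset_Box passage_subset_Box by blast
  show "curve_to s c Dom 0 0 x"
  proof (rule curve_to_convex[where P = "G ` P" and y = "G 0" and \<rho> = "w k" and d = "A k"])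
    show "convex (G ` P)"
      unfolding convex_alt
    proof clarify
      fix y z t assume "y \<in> P" "z \<in> P" "0 \<le> t" "t \<le> (1::real)"
      then have "(1 - t) *\<^sub>R y + t *\<^sub>R z \<in> P" using P(2) by (simp add: convexD)
      then show "(1 - t) *\<^sub>R G y + t *\<^sub>R G z \<in> G ` P" by (simp flip: G(5))
    qed
    show "G ` P \<subseteq> Dom"
    proof clarify
      fix z assume "z \<in> P"
      moreover from this have "F k (G z) = z" using G(2) PB by blast
      ultimately have "F k (G z) \<in> room k \<union> passage k" using P(3) by auto
      then show "G z \<in> Dom" by (rule DomI)
    qed
    show "x \<in> G ` P" using P(1) G(1) by (metis imageI)
    show "ball (G 0) (w k) \<subseteq> G ` P"
    proof
      fix v assume v: "v \<in> ball (G 0) (w k)"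
      obtain y where y: "v = G y" using G(4) by (metis surjD)
      then have "y \<in> ball 0 (w k)" using v G(3) by simp
      then show "v \<in> G ` P" using P(4) y by blast
    qed
    have "0 \<in> Box k" using b_pos by (simp add: Box_def less_imp_le)
    then show "curve_to s c Dom 0 (A k) (G 0)" by (intro node G(2))
    have "norm (F k x) \<le> real CARD('n) * (h k + w k)"
    proof (rule norm_le_card_mult)
      fix a
      have "F k x \<in> room k \<union> passage k" using P by blast
      then show "\<bar>F k x $ a\<bar> \<le> h k + w k"
        using r_less_h[of k] w_pos[of k] h_pos[of k] 
        by (auto simp: room_def passage_def simp del: F_nth dest!: spec[of _ a] split: if_splits)
    qed
    then show "dist x (G 0) \<le> A k" using G(3)[of "F k x" 0] G(1) A1[of k] by simp
  qed (use w_pos c s A3 in auto)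
qed

end

section \<open>Capacity of the passages\<close>

lemma DERIV_max_0_sq: "((\<lambda>t::real. (max 0 t)\<^sup>2) has_real_derivative 2 * max 0 t) (at t)"
proof (cases t "0::real" rule: linorder_cases)
  case less
  have "((\<lambda>t. 0) has_real_derivative 0) (at t)" by simp
  then have "((\<lambda>t::real. (max 0 t)\<^sup>2) has_real_derivative 0) (at t)"
    by (rule has_field_derivative_transform_within_open[of _ _ _ "{..<0}"]) (use less in auto)
  then show ?thesis using less by simp
next
  case greater
  have "((\<lambda>t. t\<^sup>2) has_real_derivative 2 * t) (at t)" by (auto intro!: derivative_eq_intros)
  then have "((\<lambda>t::real. (max 0 t)\<^sup>2) has_real_derivative 2 * t) (at t)"
    by (rule has_field_derivative_transform_within_open[of _ _ _ "{0<..}"]) (use greater in auto)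
  then show ?thesis using greater by simp
next
  case equal
  have "((\<lambda>h::real. max 0 h) \<longlongrightarrow> 0) (at 0)"
    using tendsto_max[OF tendsto_const tendsto_ident_at, of 0 0 UNIV] by simp
  then have "((\<lambda>h::real. (max 0 h)\<^sup>2 / h) \<longlongrightarrow> 0) (at 0)"
    by (rule Lim_transform_eventually)
       (auto simp: eventually_at power2_eq_square max_def intro!: exI[of _ 1])
  then show ?thesis using equal by (simp add: DERIV_def)
qed

text \<open>A quadratic spline: the second derivative takes the values -4 and 4 on the two halves of the
  unit interval.\<close>

definition cutoff :: "real \<Rightarrow> real" where
  "cutoff t = 1 - 2 * (max 0 t)\<^sup>2 + 4 * (max 0 (t - 1/2))\<^sup>2 - 2 * (max 0 (t - 1))\<^sup>2"
definition cutoff_deriv :: "real \<Rightarrow> real" where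
  "cutoff_deriv t = - 4 * max 0 t + 8 * max 0 (t - 1/2) - 4 * max 0 (t - 1)"

lemma DERIV_cutoff: "(cutoff has_real_derivative cutoff_deriv t) (at t)"
proof -
  have D: "((\<lambda>t. (max 0 (t - a))\<^sup>2) has_real_derivative 2 * max 0 (t - a)) (at t)" for a :: real
    using DERIV_chain2[OF DERIV_max_0_sq DERIV_diff[OF DERIV_ident DERIV_const], of a t] by simp
  show ?thesis unfolding cutoff_def[abs_def] cutoff_deriv_def
    by (rule derivative_eq_intros DERIV_max_0_sq D refl | simp)+
qed

lemma cutoff_eq: "t \<le> 0 \<Longrightarrow> cutoff t = 1" "t \<ge> 1 \<Longrightarrow> cutoff t = 0"
  by (auto simp: cutoff_def max_def power2_eq_square algebra_simps)

lemma cutoff_deriv_eq_0: "t \<le> 0 \<Longrightarrow> cutoff_deriv t = 0" by (simp add: cutoff_deriv_def)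

lemma abs_cutoff_deriv_le: "\<bar>cutoff_deriv t\<bar> \<le> 2" by (auto simp: cutoff_deriv_def max_def abs_le_iff)

lemma continuous_cutoff_deriv: "continuous_on UNIV cutoff_deriv"
  unfolding cutoff_deriv_def by (intro continuous_intros)

text \<open>Away from a zero the absolute value only multiplies by a locally constant sign, so the
  slope remains 1 or -1.\<close>

lemma abs_locally_affine:
  fixes f :: "real \<Rightarrow> real"
  assumes "\<bar>\<sigma>\<bar> = 1" and ev: "\<forall>\<^sub>F t in nhds x. f t = \<sigma> * t + d" and "f x \<noteq> 0"
  shows "\<exists>\<sigma> d. \<bar>\<sigma>\<bar> = 1 \<and> (\<forall>\<^sub>F t in nhds x. \<bar>f t\<bar> = \<sigma> * t + d)"
proof -
  define \<epsilon> where "\<epsilon> = sgn (f x)"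
  have fx: "f x = \<sigma> * x + d" using ev by (rule eventually_nhds_x_imp_x)
  have "((\<lambda>t. (\<sigma> * t + d) * \<epsilon>) \<longlongrightarrow> (\<sigma> * x + d) * \<epsilon>) (nhds x)"
    by (intro tendsto_intros) (rule filterlim_ident)
  moreover have "0 < (\<sigma> * x + d) * \<epsilon>" using assms(3) unfolding fx[symmetric] by (auto simp: \<epsilon>_def sgn_if)
  ultimately have "\<forall>\<^sub>F t in nhds x. 0 < (\<sigma> * t + d) * \<epsilon>" by (rule order_tendstoD(1))
  with ev have "\<forall>\<^sub>F t in nhds x. \<bar>f t\<bar> = \<epsilon> * \<sigma> * t + \<epsilon> * d"
  proof eventually_elim
    case (elim t)
    then have "\<bar>f t\<bar> = \<epsilon> * f t" by (auto simp: \<epsilon>_def sgn_if split: if_splits)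
    then show ?case using elim by (simp add: algebra_simps)
  qed
  moreover have "\<bar>\<epsilon> * \<sigma>\<bar> = 1" using assms by (simp add: abs_mult \<epsilon>_def abs_sgn_eq)
  ultimately show ?thesis by blast
qed

context folding_tree begin

text \<open>Points in a box of level \<open>k\<close> keep a positive distance from every earlier
  crease, so no fold bends the map near them.\<close>

lemma \<psi>_local:
  "F k x \<in> Box k \<Longrightarrow> \<exists>\<sigma> d. \<bar>\<sigma>\<bar> = 1 \<and> (\<forall>\<^sub>F t in nhds (x $ a). \<psi> k a t = \<sigma> * t + d)"
proof (induction k)
  case 0
  show ?case by (rule exI[of _ 1], rule exI[of _ 0]) simp
next
  case (Suc k)
  obtain \<sigma> d where \<sigma>: "\<bar>\<sigma>\<bar> = 1" and ev: "\<forall>\<^sub>F t in nhds (x $ a). \<psi> k a t = \<sigma> * t + d"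
    using Suc.IH[OF Box_Suc(1)[OF Suc.prems]] by blast
  show ?case
  proof (cases "a = \<alpha> k")
    case False
    then show ?thesis using \<sigma> ev by auto
  next
    case True
    have n0: "\<psi> k a (x $ a) \<noteq> 0" using Box_Suc(2)[OF Suc.prems] True r_less_g[of k] r_pos[of k] by auto
    obtain \<sigma>' d' where \<sigma>': "\<bar>\<sigma>'\<bar> = 1" and ev': "\<forall>\<^sub>F t in nhds (x $ a). \<bar>\<psi> k a t\<bar> = \<sigma>' * t + d'"
      using abs_locally_affine[OF \<sigma> ev n0] by blast
    from ev' have "\<forall>\<^sub>F t in nhds (x $ a). \<psi> (Suc k) a t = \<sigma>' * t + (d' - h k)"
      by eventually_elim (use True in simp)
    then show ?thesis using \<sigma>' by blast
  qed
qed

section \<open>The test function and its gradient\<close>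

text \<open>Normalised to be 0 at the wall of the room and 1 at distance \<open>g j\<close> from the
  crease, before the boxes of the children begin.\<close>

definition rel_depth :: "nat \<Rightarrow> real^'n \<Rightarrow> real" where
  "rel_depth j x = (\<bar>\<psi> j (\<alpha> j) (x $ \<alpha> j)\<bar> - r j) / (g j - r j)"

text \<open>Within the domain, points outside the boxes of level \<open>j\<close> belong to the part
  of the tree nearer to the root, which explains the value 1 there.\<close>

definition potential :: "nat \<Rightarrow> real^'n \<Rightarrow> real" where
  "potential j x = (if F j x \<in> Box j then cutoff (rel_depth j x) else 1)"

text \<open>At a crease of the inner absolute value the derivative is junk, but there the factor
  \<open>cutoff_deriv\<close> vanishes.\<close>

definition grad :: "nat \<Rightarrow> real^'n \<Rightarrow> real^'n" where
  "grad j x = (if x \<in> piece j then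
     axis (\<alpha> j) (cutoff_deriv (rel_depth j x) * deriv (\<lambda>t. \<bar>\<psi> j (\<alpha> j) t\<bar>) (x $ \<alpha> j) / (g j - r j)) else 0)"

text \<open>Of the pieces of lower level only passages of level \<open>j - 1\<close> enter the boxes
  of level \<open>j\<close>, and along the axis \<open>\<alpha> j\<close> they stay within the width
  of the room. Pieces of higher level lie in the boxes of the children, at relative depth at least
  1.\<close>

lemma potential_eq_const: "i < j \<Longrightarrow> x \<in> piece i \<Longrightarrow> potential j x = 1" "i > j \<Longrightarrow> x \<in> piece i \<Longrightarrow> potential j x = 0"
proof -
  assume ij: "i < j" and x: "x \<in> piece i"
  show "potential j x = 1"
  proof (cases "F j x \<in> Box j")
    case True
    then have "F (Suc i) x \<in> Box (Suc i)" using Box_mono ij by simp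
    then have p: "F i x \<in> passage i" using x room_not_Box by (auto simp: piece_def)
    then have j: "j = Suc i" using Box_mono[OF True, of "Suc (Suc i)"] passage_not_Box[OF p] ij by force
    have "\<bar>\<psi> j (\<alpha> j) (x $ \<alpha> j)\<bar> < w i"
      using passageD[OF p, of "\<alpha> j"] j axis_Suc[of i] by simp
    then have "rel_depth j x \<le> 0" using w_r(2)[of i] j r_less_g[of j] by (simp add: rel_depth_def divide_nonpos_pos del: \<psi>.simps)
    then show ?thesis by (simp add: potential_def cutoff_eq)
  qed (simp add: potential_def)
next
  assume ij: "i > j" and x: "x \<in> piece i"
  have B: "F (Suc j) x \<in> Box (Suc j)" using Box_mono[OF F_piece_Box[OF x]] ij by simp
  have "rel_depth j x \<ge> 1" using Box_Suc(2)[OF B] r_less_g[of j] by (simp add: rel_depth_def)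
  then show "potential j x = 0" using Box_Suc(1)[OF B] by (simp add: potential_def cutoff_eq)
qed

text \<open>Near a zero of the folded coordinate the depth is still nonpositive and the potential is
  constantly 1; elsewhere the absolute value is locally affine and the chain rule applies. The
  constant 4 combines the slope 2 of \<open>cutoff\<close> with
  \<open>g j - r j \<ge> g j / 2\<close>.\<close>

lemma grad_local:
  assumes x: "x \<in> piece j"
  shows "(potential j has_derivative (\<lambda>v. grad j x \<bullet> v)) (at x)" "isCont (grad j) x"
    "norm (grad j x) \<le> 4 / g j"
proof -
  let ?a = "\<alpha> j" and ?\<delta> = "g j - r j"
  have \<delta>: "?\<delta> > 0" using r_less_g[of j] by simp
  have ev_piece: "\<forall>\<^sub>F y in nhds x. y \<in> piece j" using open_piece x by (rule eventually_nhds_in_open)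
  have proj: "filterlim (\<lambda>y. y $ ?a) (nhds (x $ ?a)) (nhds x)"
    by (rule tendsto_vec_nth) (rule filterlim_ident)
  \<comment> \<open>\<open>G\<close> and \<open>H\<close> are explicit formulas that agree with the
    potential and its gradient near \<open>x\<close>; both cases below provide them.\<close>
  have "\<exists>G H. (\<forall>\<^sub>F y in nhds x. potential j y = G y \<and> grad j y = H y) \<and>
    (G has_derivative (\<lambda>v. H x \<bullet> v)) (at x) \<and> isCont H x \<and> norm (H x) \<le> 2 / ?\<delta>"
  proof (cases "\<psi> j ?a (x $ ?a) = 0")
    case True
    have "isCont (\<lambda>t. \<bar>\<psi> j ?a t\<bar>) (x $ ?a)"
      by (intro continuous_intros) (use continuous_\<psi> continuous_on_eq_continuous_at[OF open_UNIV] in blast)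
    then have "((\<lambda>t. \<bar>\<psi> j ?a t\<bar>) \<longlongrightarrow> 0) (nhds (x $ ?a))"
      using tendsto_at_iff_tendsto_nhds[of "\<lambda>t. \<bar>\<psi> j ?a t\<bar>" "x $ ?a"] True by (simp add: isCont_def)
    then have "\<forall>\<^sub>F t in nhds (x $ ?a). \<bar>\<psi> j ?a t\<bar> < r j" using r_pos by (rule order_tendstoD(2))
    from eventually_compose_filterlim[OF this proj] ev_piece
    have "\<forall>\<^sub>F y in nhds x. potential j y = 1 \<and> grad j y = 0"
    proof eventually_elim
      case (elim y)
      then have "rel_depth j y \<le> 0" using \<delta> by (simp add: rel_depth_def divide_nonpos_pos)
      then show ?case using elim by (simp add: potential_def grad_def F_piece_Box cutoff_eq cutoff_deriv_eq_0 vec_eq_iff axis_def)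
    qed
    then show ?thesis by (intro exI[of _ "\<lambda>_. 1"] exI[of _ "\<lambda>_. 0"]) (use \<delta> in simp)
  next
    case False
    obtain \<sigma> d where "\<bar>\<sigma>\<bar> = 1" "\<forall>\<^sub>F t in nhds (x $ ?a). \<psi> j ?a t = \<sigma> * t + d"
      using \<psi>_local[OF F_piece_Box[OF x]] by blast
    from abs_locally_affine[OF this False] obtain \<sigma> d where \<sigma>: "\<bar>\<sigma>\<bar> = 1"
      and ev: "\<forall>\<^sub>F t in nhds (x $ ?a). \<bar>\<psi> j ?a t\<bar> = \<sigma> * t + d" by blast
    have "\<forall>\<^sub>F t in nhds (x $ ?a). \<forall>\<^sub>F t in nhds t. \<bar>\<psi> j ?a t\<bar> = \<sigma> * t + d"
      using ev by (simp add: eventually_eventually)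
    then have "\<forall>\<^sub>F t in nhds (x $ ?a). deriv (\<lambda>t. \<bar>\<psi> j ?a t\<bar>) t = \<sigma>"
    proof eventually_elim
      case (elim t)
      have "deriv (\<lambda>t. \<bar>\<psi> j ?a t\<bar>) t = deriv (\<lambda>t. \<sigma> * t + d) t" by (rule deriv_cong_ev[OF elim refl])
      also have "\<dots> = \<sigma>" by (rule DERIV_imp_deriv) (auto intro!: derivative_eq_intros)
      finally show ?case .
    qed
    from eventually_compose_filterlim[OF this proj] eventually_compose_filterlim[OF ev proj] ev_piece
    have 1: "\<forall>\<^sub>F y in nhds x. potential j y = cutoff ((\<sigma> * y $ ?a + d - r j) / ?\<delta>) \<and>
        grad j y = axis ?a (cutoff_deriv ((\<sigma> * y $ ?a + d - r j) / ?\<delta>) * \<sigma> / ?\<delta>)"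
      by eventually_elim (simp add: potential_def grad_def rel_depth_def F_piece_Box)
    have "((\<lambda>t. cutoff ((\<sigma> * t + d - r j) / ?\<delta>)) has_real_derivative
        cutoff_deriv ((\<sigma> * t + d - r j) / ?\<delta>) * (\<sigma> / ?\<delta>)) (at t)" for t
      by (rule DERIV_chain2[OF DERIV_cutoff]) (use \<delta> in \<open>auto intro!: derivative_eq_intros\<close>)
    then have Dc: "((\<lambda>t. cutoff ((\<sigma> * t + d - r j) / ?\<delta>)) has_derivative
        (\<lambda>v. cutoff_deriv ((\<sigma> * t + d - r j) / ?\<delta>) * (\<sigma> / ?\<delta>) * v)) (at t)" for t
      by (simp only: has_field_derivative_def)
    have "((\<lambda>y::real^'n. y $ ?a) has_derivative (\<lambda>v. v $ ?a)) (at x)"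
      by (rule bounded_linear_imp_has_derivative[OF bounded_linear_vec_nth])
    from has_derivative_compose[OF this Dc]
    have 2: "((\<lambda>y. cutoff ((\<sigma> * y $ ?a + d - r j) / ?\<delta>)) has_derivative
      (\<lambda>v. axis ?a (cutoff_deriv ((\<sigma> * x $ ?a + d - r j) / ?\<delta>) * \<sigma> / ?\<delta>) \<bullet> v)) (at x)"
      by (simp add: inner_axis' mult.assoc)
    have "continuous_on UNIV (\<lambda>y::real^'n. cutoff_deriv ((\<sigma> * y $ ?a + d - r j) / ?\<delta>))"
      by (rule continuous_on_compose2[OF continuous_cutoff_deriv]) (use \<delta> in \<open>auto intro!: continuous_intros\<close>)
    then have "continuous_on UNIV (\<lambda>y::real^'n. cutoff_deriv ((\<sigma> * y $ ?a + d - r j) / ?\<delta>) * \<sigma> / ?\<delta>)"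
      using \<delta> by (intro continuous_intros) auto
    then have "continuous_on UNIV (\<lambda>y::real^'n. if i = ?a then cutoff_deriv ((\<sigma> * y $ ?a + d - r j) / ?\<delta>) * \<sigma> / ?\<delta> else 0)" for i
      by (cases "i = ?a") simp_all
    then have "continuous_on UNIV (\<lambda>y::real^'n. axis ?a (cutoff_deriv ((\<sigma> * y $ ?a + d - r j) / ?\<delta>) * \<sigma> / ?\<delta>) :: real^'n)"
      unfolding axis_def by (rule continuous_on_vec_lambda)
    then have "isCont (\<lambda>y::real^'n. axis ?a (cutoff_deriv ((\<sigma> * y $ ?a + d - r j) / ?\<delta>) * \<sigma> / ?\<delta>) :: real^'n) x"
      using continuous_on_eq_continuous_at[OF open_UNIV] by blast
    moreover have "norm (axis ?a (cutoff_deriv ((\<sigma> * x $ ?a + d - r j) / ?\<delta>) * \<sigma> / ?\<delta>) :: real^'n) \<le> 2 / ?\<delta>"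
      using \<delta> \<sigma> abs_cutoff_deriv_le by (simp add: norm_axis_eq abs_mult divide_right_mono)
    ultimately show ?thesis using 1 2
      by (intro exI[of _ "\<lambda>y. cutoff ((\<sigma> * y $ ?a + d - r j) / ?\<delta>)"]
          exI[of _ "\<lambda>y. axis ?a (cutoff_deriv ((\<sigma> * y $ ?a + d - r j) / ?\<delta>) * \<sigma> / ?\<delta>)"] conjI)
  qed
  then obtain G H where GH: "\<forall>\<^sub>F y in nhds x. potential j y = G y \<and> grad j y = H y"
    "(G has_derivative (\<lambda>v. H x \<bullet> v)) (at x)" "isCont H x" "norm (H x) \<le> 2 / ?\<delta>" by blast
  have e: "potential j x = G x \<and> grad j x = H x" using GH(1) by (rule eventually_nhds_x_imp_x)
  have ev1: "\<forall>\<^sub>F y in nhds x. grad j y = H y" using GH(1) by eventually_elim simp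
  have ev2: "\<forall>\<^sub>F y in nhds x. G y = potential j y" using GH(1) by eventually_elim simp
  show "isCont (grad j) x" using GH(3) isCont_cong[OF ev1] by simp
  have "(potential j has_derivative (\<lambda>v. H x \<bullet> v)) (at x)"
    by (rule has_derivative_transform_eventually[OF GH(2)])
      (use ev2 e in \<open>auto simp: eventually_at_filter elim: eventually_mono\<close>)
  then show "(potential j has_derivative (\<lambda>v. grad j x \<bullet> v)) (at x)" using e by simp
  have "2 / ?\<delta> \<le> 2 / (g j / 2)" using r_gap[of j] r_less_g[of j] r_pos[of j] by (intro divide_left_mono) auto
  then show "norm (grad j x) \<le> 4 / g j" using GH(4) e by simp
qed

text \<open>On pieces of another level the potential is constant. Where such a piece overlaps
  \<open>piece j\<close>, uniqueness of the derivative forces \<open>grad j\<close> to vanish, so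
  the definitions fit together.\<close>

lemma grad_Dom:
  assumes "x \<in> Dom"
  shows "(potential j has_derivative (\<lambda>v. grad j x \<bullet> v)) (at x)" "isCont (grad j) x"
proof -
  obtain i where x: "x \<in> piece i" using assms by (auto simp: Dom_def)
  have *: "(potential j has_derivative (\<lambda>v. grad j y \<bullet> v)) (at y) \<and> grad j y = 0" if "i \<noteq> j" "y \<in> piece i" for y
  proof -
    obtain c where c: "\<And>z. z \<in> piece i \<Longrightarrow> potential j z = c" 
      using potential_eq_const(1)[of i j] potential_eq_const(2)[of j i] \<open>i \<noteq> j\<close> by (meson linorder_neqE_nat)
    have "((\<lambda>_. c) has_derivative (\<lambda>_. 0)) (at y)" by simp
    then have D: "(potential j has_derivative (\<lambda>_. 0)) (at y)"
      by (rule has_derivative_transform_within_open[OF _ open_piece that(2)]) (use c in auto)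
    have "grad j y = 0"
    proof (cases "y \<in> piece j")
      case True
      from has_derivative_unique[OF grad_local(1)[OF True] D]
      have "grad j y \<bullet> grad j y = 0" by metis
      then show ?thesis by simp
    qed (simp add: grad_def)
    then show ?thesis using D by simp
  qed
  show "(potential j has_derivative (\<lambda>v. grad j x \<bullet> v)) (at x)"
    using *[OF _ x] grad_local(1)[of x j] x by (cases "i = j") blast+
  show "isCont (grad j) x"
  proof (cases "i = j")
    case False
    have "\<forall>\<^sub>F y in nhds x. grad j y = 0"
      using eventually_nhds_in_open[OF open_piece x] by eventually_elim (use * False in auto)
    from isCont_cong[OF this] show ?thesis by simp
  qed (use grad_local(2) x in auto)
qed

text \<open>\<open>potential j\<close> is the competitor. Points of \<open>Q\<close> are too close
  to the first crease to lie in a box of level 1, hence in one of level \<open>j\<close>, so the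
  potential is 1 on \<open>Q\<close>.\<close>

lemma Capacity_le_passage:
  assumes "1 \<le> p" "1 \<le> j" "E \<subseteq> piece (Suc j)" "\<And>x. x \<in> Q \<Longrightarrow> \<bar>x $ \<alpha> 0\<bar> \<le> r 0"
  shows "Capacity p E Q Dom \<le> ennreal ((4 / g j) powr p) * emeasure lborel (F j -` passage j)"
proof (rule Capacity_le_C1[OF open_Dom grad_Dom(1) _ assms(1)])
  show "continuous_on Dom (grad j)" using grad_Dom(2) by (simp add: continuous_at_imp_continuous_on)
  show "F j -` passage j \<in> sets borel"
    using continuous_F[of j] open_passage by (intro borel_open open_vimage) auto
  show "norm (grad j x) \<le> 4 / g j" for x
    using grad_local(3)[of x j] r_less_g[of j] r_pos[of j] by (cases "x \<in> piece j") (auto simp: grad_def)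
  show "grad j x = 0" if "x \<in> Dom" "x \<notin> F j -` passage j" for x
  proof (cases "x \<in> piece j")
    case True
    then have "F j x \<in> room j" using that by (simp add: piece_def)
    then have "\<bar>\<psi> j (\<alpha> j) (x $ \<alpha> j)\<bar> < r j" by (simp add: room_def)
    then have "rel_depth j x \<le> 0" using r_less_g[of j] by (simp add: rel_depth_def divide_nonpos_pos)
    then show ?thesis by (simp add: grad_def cutoff_deriv_eq_0 vec_eq_iff axis_def)
  qed (simp add: grad_def)
  show "potential j x \<le> 0" if "x \<in> E" for x using potential_eq_const(2)[of j "Suc j" x] assms(3) that by auto
  show "potential j x \<ge> 1" if "x \<in> Q" for x
  proof -
    have "F 1 x \<notin> Box 1" using Box_Suc(2)[of 0 x] assms(4)[OF that] r_less_g[of 0] by fastforce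
    then have "F j x \<notin> Box j" using Box_mono[of j x 1] assms(2) by auto
    then show ?thesis by (simp add: potential_def)
  qed
qed

end

section \<open>Volume of preimages under the folding maps\<close>

lemma emeasure_lborel_reflect_vimage:
  fixes \<sigma> d :: "'n::finite \<Rightarrow> real"
  assumes \<sigma>: "\<And>a. \<bar>\<sigma> a\<bar> = 1" and A: "A \<in> sets borel"
  shows "emeasure lborel ((\<lambda>x. \<chi> a. \<sigma> a * x $ a + d a) -` A) = emeasure lborel A"
proof -
  \<comment> \<open>\<open>c\<close> transfers the signs from coordinate indices to basis vectors,
    so that \<open>c (axis a 1) = \<sigma> a\<close>.\<close>
  define c :: "real^'n \<Rightarrow> real" where "c b = (\<Sum>a\<in>UNIV. b $ a * \<sigma> a)" for b
  define T where "T = (\<lambda>x::real^'n. (\<chi> a. d a) + (\<Sum>b\<in>Basis. (c b * (x \<bullet> b)) *\<^sub>R b))"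
  have c_axis: "c (axis a 1) = \<sigma> a" for a
    by (simp add: c_def axis_def if_distrib[of "\<lambda>x. x * _"] cong: if_cong)
  have cB: "\<bar>c b\<bar> = 1" if "b \<in> Basis" for b
    using that \<sigma> c_axis by (auto simp: Basis_vec_def)
  have T: "T = (\<lambda>x. \<chi> a. \<sigma> a * x $ a + d a)"
  proof (rule ext, subst vec_eq_iff, rule allI)
    fix x a
    have "(\<Sum>b\<in>Basis. (c b * (x \<bullet> b)) *\<^sub>R b) $ a = (\<Sum>b\<in>Basis. (c b * (x \<bullet> b)) *\<^sub>R b) \<bullet> axis a 1"
      by (simp add: inner_axis)
    also have "\<dots> = c (axis a 1) * (x \<bullet> axis a 1)" by (rule inner_sum_left_Basis) (simp add: axis_in_Basis_iff)
    finally show "T x $ a = (\<chi> a. \<sigma> a * x $ a + d a) $ a" by (simp add: T_def c_axis inner_axis)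
  qed
  have cn: "c b \<noteq> 0" if "b \<in> Basis" for b using cB[OF that] by auto
  have "(\<Prod>b\<in>Basis. \<bar>c b\<bar>) = 1" using cB by simp
  then have "(lborel :: (real^'n) measure) = distr lborel borel T"
    using lborel_affine_euclidean[of c "\<chi> a. d a", OF cn] by (simp add: T_def density_1)
  then have "emeasure lborel A = emeasure (distr lborel borel T) A" by simp
  also have "\<dots> = emeasure lborel (T -` A)"
    using A by (subst emeasure_distr) (auto simp: T_def)
  finally show ?thesis by (simp add: T)
qed

context folding_tree begin

text \<open>At every point a fold agrees with one of two volume-preserving reflections, so taking a
  preimage at most doubles the volume.\<close>

lemma emeasure_F_vimage_le:
  assumes "A \<in> sets borel"
  shows "emeasure lborel (F j -` A) \<le> 2 ^ j * emeasure lborel A"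
  using assms
proof (induction j arbitrary: A)
  case 0
  have "F 0 -` A = A" by auto
  then show ?case by simp
next
  case (Suc j)
  define T where "T = (\<lambda>\<epsilon> (x::real^'n). \<chi> a. (if a = \<alpha> j then \<epsilon> else 1) * x $ a + (if a = \<alpha> j then - h j else 0))"
  have cT: "continuous_on UNIV (T \<epsilon>)" for \<epsilon>
    unfolding T_def by (intro continuous_on_vec_lambda continuous_intros)
  then have sT: "T \<epsilon> -` A \<in> sets borel" for \<epsilon>
    using measurable_sets[OF borel_measurable_continuous_onI[OF cT] Suc.prems] by simp
  have eT: "emeasure lborel (T \<epsilon> -` A) = emeasure lborel A" if "\<bar>\<epsilon>\<bar> = 1" for \<epsilon>
    unfolding T_def by (rule emeasure_lborel_reflect_vimage) (use that Suc.prems in auto)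
  have "fld j z = T 1 z \<or> fld j z = T (-1) z" for z
    by (cases "z $ \<alpha> j \<ge> 0") (auto simp: fld_def T_def vec_eq_iff)
  then have sub: "F (Suc j) -` A \<subseteq> F j -` (T 1 -` A \<union> T (-1) -` A)"
    
    by (auto simp: F_Suc simp del: F_nth) metis
  have "F j -` (T 1 -` A \<union> T (-1) -` A) \<in> sets borel"
    using measurable_sets[OF borel_measurable_continuous_onI[OF continuous_F[of j]] sets.Un[OF sT sT]] by simp
  then have "emeasure lborel (F (Suc j) -` A) \<le> emeasure lborel (F j -` (T 1 -` A \<union> T (-1) -` A))"
    by (intro emeasure_mono[OF sub]) simp
  also have "\<dots> \<le> 2 ^ j * emeasure lborel (T 1 -` A \<union> T (-1) -` A)"
    by (rule Suc.IH) (use sT in auto)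
  also have "\<dots> \<le> 2 ^ j * (emeasure lborel (T 1 -` A) + emeasure lborel (T (-1) -` A))"
    by (intro mult_left_mono emeasure_subadditive) (use sT in auto)
  also have "\<dots> = 2 ^ Suc j * emeasure lborel A"
    by (simp add: eT algebra_simps flip: mult_2)
  finally show ?case .
qed

lemma emeasure_passage_le:
  "emeasure lborel (passage k) \<le> ennreal (2 ^ CARD('n) * ((h k + w k) * w k ^ (CARD('n) - 1)))"
proof -
  define c where "c = (\<chi> a. if a = \<alpha> k then h k + w k else w k)"
  have c: "c $ a > 0" for a using h_pos[of k] w_pos[of k] by (simp add: c_def)
  have "emeasure lborel (passage k) \<le> emeasure lborel (cbox (-c) c)"
    by (intro emeasure_mono) (auto simp: passage_def c_def mem_box_cart abs_less_iff less_imp_le minus_le_iff split: if_splits)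
  also have "\<dots> = ennreal (measure lborel (cbox (-c) c))"
    by (intro emeasure_eq_ennreal_measure) (use emeasure_lborel_cbox_finite[of "- c" c] in auto)
  also have "measure lborel (cbox (-c) c) = (\<Prod>a\<in>UNIV. c $ a - (- c) $ a)"
    by (rule content_cbox_cart) (use c in \<open>auto simp: interval_ne_empty_cart less_imp_le\<close>)
  also have "\<dots> = (\<Prod>a\<in>UNIV. 2 * c $ a)" by simp
  also have "\<dots> = 2 ^ CARD('n) * (\<Prod>a\<in>UNIV. c $ a)" by (simp add: prod.distrib)
  also have "(\<Prod>a\<in>UNIV. c $ a) = c $ \<alpha> k * (\<Prod>a\<in>UNIV - {\<alpha> k}. c $ a)" by (rule prod.remove) auto
  also have "(\<Prod>a\<in>UNIV - {\<alpha> k}. c $ a) = (\<Prod>a\<in>UNIV - {\<alpha> k}. w k)" by (rule prod.cong) (auto simp: c_def)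
  also have "\<dots> = w k ^ (CARD('n) - 1)" by (simp add: card_Diff_singleton)
  finally show ?thesis by (simp add: c_def)
qed

lemma Capacity_le:
  assumes "1 \<le> p" "1 \<le> j" "E \<subseteq> piece (Suc j)" "\<And>x. x \<in> Q \<Longrightarrow> \<bar>x $ \<alpha> 0\<bar> \<le> r 0"
  shows "Capacity p E Q Dom \<le>
    ennreal ((4 / g j) powr p * (2 ^ j * (2 ^ CARD('n) * ((h j + w j) * w j ^ (CARD('n) - 1)))))"
proof -
  have "Capacity p E Q Dom \<le> ennreal ((4 / g j) powr p) * emeasure lborel (F j -` passage j)"
    by (rule Capacity_le_passage[OF assms])
  also have "\<dots> \<le> ennreal ((4 / g j) powr p) * (2 ^ j * emeasure lborel (passage j))"
    by (intro mult_left_mono emeasure_F_vimage_le) (auto intro: borel_open open_passage)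
  also have "\<dots> \<le> ennreal ((4 / g j) powr p) * (ennreal (2 ^ j) * ennreal (2 ^ CARD('n) * ((h j + w j) * w j ^ (CARD('n) - 1))))"
    by (intro mult_left_mono mult_mono emeasure_passage_le) (auto simp: ennreal_power[symmetric])
  also have "\<dots> = ennreal ((4 / g j) powr p * (2 ^ j * (2 ^ CARD('n) * ((h j + w j) * w j ^ (CARD('n) - 1)))))"
    using h_pos[of j] w_pos[of j] by (simp add: ennreal_mult[symmetric] del: ennreal_power)
  finally show ?thesis .
qed

section \<open>The compact sets\<close>

text \<open>The rooms \<open>d\<close> levels below a node of level \<open>m\<close>, seen from that
  node and halved to closed cubes. The recursion peels off the fold nearest to the root, as the
  induction for the content requires.\<close>

fun core :: "nat \<Rightarrow> nat \<Rightarrow> (real^'n) set" where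
  "core 0 m = {z. \<forall>a. \<bar>z $ a\<bar> \<le> r m / 2}"
| "core (Suc d) m = fld m -` core d (Suc m)"

lemma core_0: "core 0 m = cbox (\<chi> a. - (r m / 2)) (\<chi> a. r m / 2)"
proof -
  have "\<bar>t\<bar> \<le> r m / 2 \<longleftrightarrow> - (r m / 2) \<le> t \<and> t \<le> r m / 2" for t by linarith
  then show ?thesis by (simp add: set_eq_iff mem_box_cart)
qed

lemma F_vimage_core: "F m -` core d m = F (m + d) -` core 0 (m + d)"
proof (induction d arbitrary: m)
  case (Suc d)
  have "F m -` core (Suc d) m = F (Suc m) -` core d (Suc m)" by (auto simp: F_Suc)
  then show ?case using Suc.IH[of "Suc m"] by simp
qed simp

lemma core_subset_Box: "core d m \<subseteq> Box m"
proof (induction d arbitrary: m)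
  case 0
  have "r m / 2 \<le> b m a" for a using r_b[of m a] r_pos[of m] by simp
  then show ?case unfolding Box_def core.simps by (blast intro: order_trans)
next
  case (Suc d)
  then show ?case using Box_fld(1) by auto
qed

lemma core_eq_0: "core k 0 = F k -` core 0 k"
  using F_vimage_core[of 0 k] by (simp add: vimage_def)

lemma core_subset_piece: "core k 0 \<subseteq> piece k"
proof -
  have "r k / 2 < r k" using r_pos[of k] by simp
  then have "core 0 k \<subseteq> room k" unfolding room_def core.simps by (blast intro: order_le_less_trans)
  then show ?thesis unfolding core_eq_0 piece_def by blast
qed

lemma compact_core: "compact (core k 0)"
proof -
  have "closed (core 0 k)" by (simp only: core_0 closed_cbox)
  then have "closed (core k 0)" unfolding core_eq_0 using continuous_F by (intro closed_vimage) auto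
  moreover have "bounded (core k 0)"
    using core_subset_piece bounded_Dom by (rule_tac bounded_subset[of Dom]) (auto simp: Dom_def)
  ultimately show ?thesis by (simp add: compact_eq_bounded_closed)
qed


end

section \<open>Hausdorff content of the rooms\<close>

text \<open>A ball of radius at least \<open>t\<close> suffices by its own term. Otherwise volumes
  are compared, using \<open>\<rho> ^ n \<le> t powr (n - q) * \<rho> powr q\<close> for
  \<open>\<rho> \<le> t\<close> and \<open>n\<close> the dimension. The indicator of
  \<open>I\<close> allows passing to subfamilies without renumbering.\<close>

lemma cube_cover_sum_ge:
  fixes x :: "nat \<Rightarrow> real^'n" and t q :: real
  assumes t: "0 < t" and q: "0 < q" "q \<le> real CARD('n)" and \<rho>: "\<And>i. 0 < \<rho> i"
    and cover: "cbox (\<chi> a. - (t / 2)) (\<chi> a. t / 2) \<subseteq> (\<Union>i\<in>I. ball (x i) (\<rho> i))"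
  shows "ennreal (t powr q / 2 ^ CARD('n)) \<le> (\<Sum>i. ennreal (\<rho> i powr q) * indicator I i)"
proof (cases "\<exists>i\<in>I. t \<le> \<rho> i")
  case True
  then obtain i where i: "i \<in> I" "t \<le> \<rho> i" by blast
  have "t powr q / 2 ^ CARD('n) \<le> t powr q / 1" by (intro divide_left_mono) auto
  also have "\<dots> \<le> \<rho> i powr q" using i t q by (simp add: powr_mono2)
  finally have "ennreal (t powr q / 2 ^ CARD('n)) \<le> (\<Sum>j\<in>{i}. ennreal (\<rho> j powr q) * indicator I j)"
    using i by (simp add: ennreal_leI)
  also have "\<dots> \<le> (\<Sum>i. ennreal (\<rho> i powr q) * indicator I i)"
    by (rule sum_le_suminf) (auto intro: summableI)
  finally show ?thesis .
next
  case False
  let ?n = "CARD('n)"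
  let ?S = "\<Sum>i. ennreal (\<rho> i powr q) * indicator I i"
  \<comment> \<open>With this constant the volume of a ball of radius \<open>\<rho> \<le> t\<close>
    is at most \<open>K * \<rho> powr q\<close>.\<close>
  define K where "K = 2 ^ ?n * t powr (real ?n - q)"
  have K: "K > 0" using t by (simp add: K_def)
  define B where "B = (\<lambda>i. if i \<in> I then ball (x i) (\<rho> i) else {})"
  have vol: "emeasure lborel (cbox (u - (\<chi> a. \<tau>)) (u + (\<chi> a. \<tau>)) :: (real^'n) set) = ennreal ((2 * \<tau>) ^ ?n)"
    if "0 < \<tau>" for u :: "real^'n" and \<tau>
  proof -
    have "emeasure lborel (cbox (u - (\<chi> a. \<tau>)) (u + (\<chi> a. \<tau>))) = ennreal (measure lborel (cbox (u - (\<chi> a. \<tau>)) (u + (\<chi> a. \<tau>))))"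
      by (intro emeasure_eq_ennreal_measure) (use emeasure_lborel_cbox_finite[of "u - (\<chi> a. \<tau>)" "u + (\<chi> a. \<tau>)"] in auto)
    also have "measure lborel (cbox (u - (\<chi> a. \<tau>)) (u + (\<chi> a. \<tau>))) = (2 * \<tau>) ^ ?n"
      by (subst content_cbox_cart) (use that in \<open>auto simp: interval_ne_empty_cart\<close>)
    finally show ?thesis .
  qed
  have "ennreal (t ^ ?n) = emeasure lborel (cbox (\<chi> a. - (t / 2)) (\<chi> a. t / 2) :: (real^'n) set)"
  proof -
    have "0 - (\<chi> a. t / 2) = (\<chi> a. - (t / 2) :: real^'n)" by (simp add: vec_eq_iff)
    then show ?thesis using vol[of "t/2" 0] t by simp
  qed
  also have "\<dots> \<le> emeasure lborel (\<Union>i. B i)"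
    using cover by (intro emeasure_mono) (auto simp: B_def)
  also have "\<dots> \<le> (\<Sum>i. emeasure lborel (B i))"
    by (rule emeasure_subadditive_countably) (auto simp: B_def)
  also have "\<dots> \<le> (\<Sum>i. ennreal K * (ennreal (\<rho> i powr q) * indicator I i))"
  proof (rule suminf_le)
    fix i
    show "emeasure lborel (B i) \<le> ennreal K * (ennreal (\<rho> i powr q) * indicator I i)"
    proof (cases "i \<in> I")
      case True
      then have le: "\<rho> i \<le> t" using False by force
      have "ball (x i) (\<rho> i) \<subseteq> cbox (x i - (\<chi> a. \<rho> i)) (x i + (\<chi> a. \<rho> i))"
      proof
        fix z assume "z \<in> ball (x i) (\<rho> i)"
        then have "\<bar>x i $ a - z $ a\<bar> < \<rho> i" for a
          using component_le_norm_cart[of "x i - z" a] by (simp add: dist_norm)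
        then have "x i $ a - \<rho> i \<le> z $ a \<and> z $ a \<le> x i $ a + \<rho> i" for a
          by (simp add: abs_less_iff algebra_simps less_imp_le)
        then show "z \<in> cbox (x i - (\<chi> a. \<rho> i)) (x i + (\<chi> a. \<rho> i))" by (simp add: mem_box_cart)
      qed
      then have "emeasure lborel (ball (x i) (\<rho> i)) \<le> ennreal ((2 * \<rho> i) ^ ?n)"
        using vol[OF \<rho>[of i], of "x i"] by (metis emeasure_mono cbox_borel sets_lborel)
      also have "(2 * \<rho> i) ^ ?n = 2 ^ ?n * (\<rho> i powr (real ?n - q) * \<rho> i powr q)"
        using \<rho>[of i] by (simp add: powr_add[symmetric] powr_realpow power_mult_distrib)
      also have "\<dots> \<le> 2 ^ ?n * (t powr (real ?n - q) * \<rho> i powr q)"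
        using le \<rho>[of i] q by (intro mult_left_mono mult_right_mono powr_mono2) auto
      finally show ?thesis using True K by (simp add: B_def K_def ennreal_mult[symmetric] mult.assoc ennreal_leI)
    qed (simp add: B_def)
  qed (auto intro: summableI)
  also have "\<dots> = ennreal K * ?S" by (rule ennreal_suminf_cmult)
  finally have "ennreal (1 / K) * ennreal (t ^ ?n) \<le> ennreal (1 / K) * (ennreal K * ?S)"
    by (rule mult_left_mono) simp
  also have "\<dots> = ?S" using K by (simp add: mult.assoc[symmetric] ennreal_mult[symmetric])
  also have "ennreal (1 / K) * ennreal (t ^ ?n) = ennreal (t ^ ?n / K)"
    using K t by (simp add: ennreal_mult[symmetric])
  also have "t ^ ?n / K = t powr q / 2 ^ ?n"
    using t by (simp add: K_def powr_diff powr_realpow)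
  finally show ?thesis .
qed

context folding_tree begin

text \<open>Induction on the number of remaining levels: either some ball is as large as the gap and its
  term alone suffices, or no ball meets both halves and the cover splits into covers of the two
  children.\<close>

lemma core_cover_sum_ge:
  fixes q c :: real
  assumes q: "0 < q" "q \<le> real CARD('n)" and c: "0 \<le> c" "\<And>m. c / 2 ^ m \<le> r m powr q"
    and \<rho>: "\<And>i. 0 < \<rho> i" and cover: "core d m \<subseteq> (\<Union>i\<in>I. ball (x i) (\<rho> i))"
  shows "ennreal (c / 2 ^ m / 2 ^ CARD('n)) \<le> (\<Sum>i. ennreal (\<rho> i powr q) * indicator I i)"
  using cover
proof (induction d arbitrary: m I x)
  case 0
  have "ennreal (c / 2 ^ m / 2 ^ CARD('n)) \<le> ennreal (r m powr q / 2 ^ CARD('n))"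
    using c(2)[of m] by (intro ennreal_leI divide_right_mono) auto
  also have "\<dots> \<le> (\<Sum>i. ennreal (\<rho> i powr q) * indicator I i)"
    by (rule cube_cover_sum_ge[OF r_pos q \<rho>]) (use 0 in \<open>simp only: core_0\<close>)
  finally show ?case .
next
  case (Suc d)
  let ?a = "\<alpha> m"
  show ?case
  proof (cases "\<exists>i\<in>I. g m \<le> \<rho> i")
    case True
    then obtain i where i: "i \<in> I" "g m \<le> \<rho> i" by blast
    \<comment> \<open>One such ball is enough because \<open>r m < g m\<close> and the target is at
      most \<open>r m powr q\<close>.\<close>
    have "c / 2 ^ m / 2 ^ CARD('n) \<le> c / 2 ^ m / 1" using c(1) by (intro divide_left_mono) auto
    also have "\<dots> \<le> r m powr q" using c(2)[of m] by simp
    also have "\<dots> \<le> \<rho> i powr q" using i r_less_g[of m] r_pos[of m] q by (intro powr_mono2) auto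
    finally have "ennreal (c / 2 ^ m / 2 ^ CARD('n)) \<le> (\<Sum>j\<in>{i}. ennreal (\<rho> j powr q) * indicator I j)"
      using i by (simp add: ennreal_leI)
    also have "\<dots> \<le> (\<Sum>i. ennreal (\<rho> i powr q) * indicator I i)"
      by (rule sum_le_suminf) (auto intro: summableI)
    finally show ?thesis .
  next
    case False
    \<comment> \<open>\<open>J \<epsilon>\<close> collects the balls that reach the side
      \<open>\<epsilon>\<close> of the gap; \<open>T \<epsilon>\<close> is the fold as it acts on
      that side, extended to an isometry of the whole space so that it maps balls to balls.\<close>
    define J where "J = (\<lambda>\<epsilon>. {i\<in>I. \<exists>z\<in>ball (x i) (\<rho> i). g m \<le> \<epsilon> * z $ ?a})"
    define T where "T = (\<lambda>\<epsilon> (z::real^'n). \<chi> a. if a = ?a then \<epsilon> * z $ a - h m else z $ a)"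
    have half: "ennreal (c / 2 ^ Suc m / 2 ^ CARD('n)) \<le> (\<Sum>i. ennreal (\<rho> i powr q) * indicator (J \<epsilon>) i)"
      if \<epsilon>: "\<epsilon> = 1 \<or> \<epsilon> = -1" for \<epsilon>
    proof (rule Suc.IH)
      have T_dist: "dist (T \<epsilon> y) (T \<epsilon> z) = dist y z" for y z
      proof -
        have "dist (T \<epsilon> y $ a) (T \<epsilon> z $ a) = dist (y $ a) (z $ a)" for a
          using \<epsilon> by (auto simp: T_def dist_real_def)
        then show ?thesis by (simp add: dist_vec_def)
      qed
      show "core d (Suc m) \<subseteq> (\<Union>i\<in>J \<epsilon>. ball (T \<epsilon> (x i)) (\<rho> i))"
      proof
        fix y assume y: "y \<in> core d (Suc m)"
        \<comment> \<open>The point on the side \<open>\<epsilon>\<close> that is folded onto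
          \<open>y\<close>.\<close>
        define z where "z = (\<chi> a. if a = ?a then \<epsilon> * (y $ a + h m) else y $ a)"
        have "\<bar>y $ ?a\<bar> \<le> b (Suc m) ?a" using y core_subset_Box by (auto simp: Box_def)
        then have pos: "y $ ?a + h m > 0" using b_less_h[of m] by linarith
        have fz: "fld m z = y" using pos \<epsilon> by (auto simp: fld_def z_def vec_eq_iff)
        then have zc: "z \<in> core (Suc d) m" using y by simp
        then obtain i where i: "i \<in> I" "z \<in> ball (x i) (\<rho> i)" using Suc.prems by blast
        have "fld m z \<in> Box (Suc m)" using fz y core_subset_Box by blast
        then have "g m \<le> \<bar>z $ ?a\<bar>" by (rule Box_fld(2))
        also have "\<bar>z $ ?a\<bar> = \<epsilon> * z $ ?a" using pos \<epsilon> by (auto simp: z_def)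
        finally have "i \<in> J \<epsilon>" using i by (auto simp: J_def)
        moreover have "T \<epsilon> z = y" using \<epsilon> by (auto simp: T_def z_def vec_eq_iff)
        then have "y \<in> ball (T \<epsilon> (x i)) (\<rho> i)" using i(2) T_dist[of "x i" z] by simp
        ultimately show "y \<in> (\<Union>i\<in>J \<epsilon>. ball (T \<epsilon> (x i)) (\<rho> i))" by blast
      qed
    qed
    have disj: "J 1 \<inter> J (-1) = {}"
    proof (rule ccontr)
      assume "J 1 \<inter> J (-1) \<noteq> {}"
      then obtain i z z' where i: "i \<in> I" "z \<in> ball (x i) (\<rho> i)" "g m \<le> z $ ?a"
        "z' \<in> ball (x i) (\<rho> i)" "g m \<le> - z' $ ?a" by (auto simp: J_def)
      \<comment> \<open>A ball reaching both sides would contain two points at distance at least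
        \<open>2 * g m\<close>, although its radius is below \<open>g m\<close>.\<close>
      have "2 * g m \<le> \<bar>(z - z') $ ?a\<bar>" using i by simp
      also have "\<dots> \<le> dist z z'" unfolding dist_norm by (rule component_le_norm_cart)
      also have "\<dots> < 2 * \<rho> i" using i dist_triangle2[of z z' "x i"] by (simp add: dist_commute)
      finally show False using False i(1) by force
    qed
    have "ennreal (c / 2 ^ m / 2 ^ CARD('n)) = ennreal (c / 2 ^ Suc m / 2 ^ CARD('n)) + ennreal (c / 2 ^ Suc m / 2 ^ CARD('n))"
      using c(1) by (subst ennreal_plus[symmetric]) (auto simp: field_simps)
    also have "\<dots> \<le> (\<Sum>i. ennreal (\<rho> i powr q) * indicator (J 1) i) + (\<Sum>i. ennreal (\<rho> i powr q) * indicator (J (-1)) i)"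
      by (intro add_mono half) simp_all
    also have "\<dots> = (\<Sum>i. ennreal (\<rho> i powr q) * indicator (J 1) i + ennreal (\<rho> i powr q) * indicator (J (-1)) i)"
      by (rule suminf_add) (auto intro: summableI)
    also have "\<dots> \<le> (\<Sum>i. ennreal (\<rho> i powr q) * indicator I i)"
    proof (rule suminf_le)
      fix i
      have "J 1 \<subseteq> I" "J (-1) \<subseteq> I" by (auto simp: J_def)
      then have "i \<in> I" if "i \<in> J 1 \<or> i \<in> J (-1)" using that by blast
      moreover have "i \<notin> J 1 \<or> i \<notin> J (-1)" using disj by blast
      ultimately show "ennreal (\<rho> i powr q) * indicator (J 1) i + ennreal (\<rho> i powr q) * indicator (J (-1)) i
          \<le> ennreal (\<rho> i powr q) * indicator I i"
        by (cases "i \<in> J 1"; cases "i \<in> J (-1)") simp_all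
    qed (rule summableI)+
    finally show ?thesis .
  qed
qed

lemma Hausdorff_content_core_ge:
  fixes q c :: real
  assumes "0 < q" "q \<le> real CARD('n)" "0 \<le> c" "\<And>m. c / 2 ^ m \<le> r m powr q"
  shows "ennreal (c / 2 ^ CARD('n)) \<le> Hausdorff_content q (core k 0)"
  unfolding Hausdorff_content_def
proof (rule INF_greatest, clarify)
  fix x :: "nat \<Rightarrow> real^'n" and \<rho> :: "nat \<Rightarrow> real"
  assume "\<forall>i. 0 < \<rho> i" "core k 0 \<subseteq> (\<Union>i. ball (x i) (\<rho> i))"
  then have "ennreal (c / 2 ^ 0 / 2 ^ CARD('n)) \<le> (\<Sum>i. ennreal (\<rho> i powr q) * indicator UNIV i)"
    by (intro core_cover_sum_ge[OF assms, of \<rho>]) blast+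
  then show "ennreal (c / 2 ^ CARD('n)) \<le> (\<Sum>i. ennreal (\<rho> i powr q))" by simp
qed

text \<open>Bounds the size of the central Whitney cube. The witness is the centre of a face of the
  root room transverse to \<open>\<alpha> 1\<close>: it misses the passage since
  \<open>w 0 \<le> r 0\<close>, and the deeper pieces since it lies on the crease of the first
  fold.\<close>

lemma infdist_frontier_Dom_le: "infdist 0 (frontier Dom) \<le> r 0"
proof -
  define z where "z = (axis (\<alpha> 1) (r 0) :: real^'n)"
  have z: "z $ \<alpha> 1 = r 0" "z $ \<alpha> 0 = 0" using axis_Suc[of 0] by (auto simp: z_def axis_def)
  have "z \<notin> Dom"
  proof
    assume "z \<in> Dom"
    then obtain k where k: "z \<in> piece k" by (auto simp: Dom_def)
    show False
    proof (cases k)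
      case 0
      then have "z \<in> room 0 \<or> z \<in> passage 0" using k by (simp add: piece_def)
      then show False
      proof
        assume "z \<in> room 0"
        then have "\<bar>z $ \<alpha> 1\<bar> < r 0" by (simp add: room_def)
        then show False using z r_pos[of 0] by simp
      next
        assume "z \<in> passage 0"
        from passageD[OF this, of "\<alpha> 1"] show False using z axis_Suc[of 0] r_pos[of 0] w_r(1)[of 0] by simp
      qed
    next
      case (Suc i)
      then have "F 1 z \<in> Box 1" using Box_mono[OF F_piece_Box[OF k], of 1] by simp
      then show False using Box_Suc(2)[of 0 z] z r_less_g[of 0] r_pos[of 0] by simp
    qed
  qed
  then have "closed_segment 0 z \<inter> frontier Dom \<noteq> {}"
    using zero_in_Dom by (intro connected_Int_frontier) auto
  then obtain y where y: "y \<in> closed_segment 0 z" "y \<in> frontier Dom" by blast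
  have "infdist 0 (frontier Dom) \<le> dist 0 y" by (rule infdist_le[OF y(2)])
  also have "\<dots> \<le> dist 0 z" using dist_in_closed_segment[OF y(1)] by (simp add: dist_commute)
  also have "\<dots> = r 0" using r_pos[of 0] by (simp add: z_def norm_axis_eq)
  finally show ?thesis .
qed

end

section \<open>Choice of the parameters\<close>

lemma ex_mod_between:
  fixes n i k :: nat assumes "i < n" shows "\<exists>m\<ge>k. m \<le> k + n \<and> m mod n = i"
proof -
  define m where "m = k + (i + n - k mod n) mod n"
  have n: "n > 0" using assms by simp
  have "m mod n = (k mod n + (i + n - k mod n)) mod n" by (simp add: m_def mod_add_eq mod_add_right_eq mod_add_left_eq)
  also have "k mod n + (i + n - k mod n) = i + n" using mod_less_divisor[OF n, of k] by linarith
  finally have "m mod n = i" using assms by simp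
  moreover have "m \<le> k + n" using mod_less_divisor[OF n, of "i + n - k mod n"] by (simp add: m_def)
  ultimately show ?thesis by (intro exI[of _ m]) (simp add: m_def)
qed

text \<open>The extent of a box along an axis shrinks only at folds in this axis, so
  \<open>b k a\<close> is \<open>B\<close> at the first level from \<open>k\<close> on that uses
  \<open>a\<close>. The axis of level \<open>k\<close> returns exactly \<open>n\<close> levels
  later, \<open>n\<close> being the dimension, which accounts for the differences of
  \<open>B\<close>.\<close>

lemma ex_folding_tree:
  fixes B r w :: "nat \<Rightarrow> real"
  assumes n: "CARD('n::finite) \<ge> 2" and dec: "decseq B"
    and r: "\<And>k. 2 * r k \<le> B k - 2 * B (k + CARD('n))" "\<And>k. r k \<le> B (k + CARD('n))"
    and w: "\<And>k. 0 < w k" "\<And>k. w k \<le> r k" "\<And>k. w k \<le> r (Suc k)"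
  shows "\<exists>(\<alpha> :: nat \<Rightarrow> 'n) b. folding_tree \<alpha> b (\<lambda>k. B k - B (k + CARD('n))) (\<lambda>k. B k - 2 * B (k + CARD('n))) r w"
proof -
  let ?n = "CARD('n)"
  obtain e :: "nat \<Rightarrow> 'n" where e: "bij_betw e {..<?n} UNIV"
    using ex_bij_betw_nat_finite[OF finite[of "UNIV :: 'n set"]] by (auto simp: lessThan_atLeast0)
  have n0: "?n > 0" by simp
  define \<alpha> where "\<alpha> = (\<lambda>k. e (k mod ?n))"
  have \<alpha>_eq: "\<alpha> k = \<alpha> m \<longleftrightarrow> k mod ?n = m mod ?n" for k m
    unfolding \<alpha>_def using e n0 by (auto simp: bij_betw_def dest: inj_onD)
  define nxt where "nxt = (\<lambda>k a. LEAST m. k \<le> m \<and> \<alpha> m = a)"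
  have ex: "\<exists>m. k \<le> m \<and> m \<le> k + ?n \<and> \<alpha> m = a" for k a
  proof -
    obtain i where i: "i < ?n" "e i = a" using e by (metis bij_betw_imp_surj_on imageE lessThan_iff UNIV_I)
    then show ?thesis using ex_mod_between[OF i(1), of k] by (auto simp: \<alpha>_def)
  qed
  have nxt_le: "nxt k a \<le> k + ?n" for k a
  proof -
    obtain m where "k \<le> m" "m \<le> k + ?n" "\<alpha> m = a" using ex by blast
    then have "nxt k a \<le> m" unfolding nxt_def by (intro Least_le) simp
    then show ?thesis using \<open>m \<le> k + ?n\<close> by simp
  qed
  have nxt_other: "nxt (Suc k) a = nxt k a" if "a \<noteq> \<alpha> k" for k a
  proof -
    have "Suc k \<le> m \<and> \<alpha> m = a \<longleftrightarrow> k \<le> m \<and> \<alpha> m = a" for m using that by (auto simp: Suc_le_eq order_le_less)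
    then show ?thesis by (simp add: nxt_def)
  qed
  have nxt_self: "nxt k (\<alpha> k) = k" for k unfolding nxt_def by (rule Least_equality) auto
  have nxt_Suc: "nxt (Suc k) (\<alpha> k) = k + ?n" for k
    unfolding nxt_def
  proof (rule Least_equality)
    show "Suc k \<le> k + ?n \<and> \<alpha> (k + ?n) = \<alpha> k" using n0 by (simp add: \<alpha>_def)
    fix m assume m: "Suc k \<le> m \<and> \<alpha> m = \<alpha> k"
    then have "?n dvd m - k" using \<alpha>_eq[of m k] mod_eq_dvd_iff_nat[of k m ?n] by auto
    then have "?n \<le> m - k" using m by (intro dvd_imp_le) auto
    then show "k + ?n \<le> m" using m by linarith
  qed
  have "folding_tree \<alpha> (\<lambda>k a. B (nxt k a)) (\<lambda>k. B k - B (k + ?n)) (\<lambda>k. B k - 2 * B (k + ?n)) r w"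
  proof
    show "\<alpha> (Suc k) \<noteq> \<alpha> k" for k
    proof
      assume "\<alpha> (Suc k) = \<alpha> k"
      then have "Suc k mod ?n = k mod ?n" by (simp only: \<alpha>_eq)
      then have "?n dvd Suc k - k" by (subst (asm) mod_eq_dvd_iff_nat) auto
      then show False using n by simp
    qed
    show "r k \<le> B (nxt k a)" for k a
      using r(2)[of k] decseqD[OF dec nxt_le[of k a]] by linarith
  qed (use r w in \<open>simp_all add: nxt_other nxt_self nxt_Suc\<close>)
  then show ?thesis by blast
qed

lemma powr_le_const_mult_power:
  fixes a y :: real assumes "y > 1"
  shows "\<exists>D>0. \<forall>k::nat. (real k + 1) powr a \<le> D * y ^ k"
proof -
  have "(\<lambda>k::nat. (real k + 1) powr a / y ^ k) \<longlonglongrightarrow> 0" using assms by real_asymp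
  then have "Bseq (\<lambda>k::nat. (real k + 1) powr a / y ^ k)" by (rule convergent_imp_Bseq[OF convergentI])
  then obtain D where D: "D > 0" "\<And>k. norm ((real k + 1) powr a / y ^ k) \<le> D" by (auto simp: Bseq_def)
  have "(real k + 1) powr a \<le> D * y ^ k" for k
    using D(2)[of k] assms by (simp add: pos_divide_le_eq)
  then show ?thesis using D(1) by blast
qed

text \<open>Everything is tied to one sequence \<open>B\<close>: \<open>r\<close> is as large as the
  tree conditions allow, \<open>w\<close> is a multiple of \<open>B k powr s\<close> and
  \<open>A\<close> a multiple of \<open>B\<close>. The conclusions concern, in this order, the tree,
  the John condition, the content and the capacity.\<close>

lemma ex_parameters:
  fixes s p lam :: real and n :: nat
  assumes n: "2 \<le> n" and s: "1 \<le> s" and p: "1 \<le> p" and lam: "0 < lam" "lam \<le> real n"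
    and s1: "s = 1 \<Longrightarrow> lam < real n"
  obtains B r w :: "nat \<Rightarrow> real" and c :: real and A :: "nat \<Rightarrow> real" where
    "decseq B" "\<And>k. 2 * r k \<le> B k - 2 * B (k + n)" "\<And>k. r k \<le> B (k + n)"
    "\<And>k. 0 < w k" "\<And>k. w k \<le> r k" "\<And>k. w k \<le> r (Suc k)"
    "0 < c" "\<And>k. real n * (B k - B (k + n) + w k) \<le> A k"
    "\<And>k. A (Suc k) + (B k - B (k + n)) \<le> A k" "\<And>k. c * A k powr s \<le> w k"
    "\<And>q. 0 < q \<Longrightarrow> q < lam \<Longrightarrow> \<exists>c>0. \<forall>k. c / 2 ^ k \<le> r k powr q"
    "lam \<le> (real n - 1) * s + 1 - p \<Longrightarrow>
      (\<lambda>k. (4 / (B k - 2 * B (k + n))) powr p * (2 ^ k * (2 ^ n * ((B k - B (k + n) + w k) * w k ^ (n - 1))))) \<longlonglongrightarrow> 0"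
proof -
  \<comment> \<open>Chosen so that \<open>2 * \<theta> powr lam = 1\<close>: the growth of the
    number of nodes is balanced by the decay of their size to the power \<open>lam\<close>.\<close>
  define \<theta> where "\<theta> = (2::real) powr (- 1 / lam)"
  have \<theta>: "0 < \<theta>" "\<theta> < 1" using lam by (auto simp: \<theta>_def powr_less_one)
  have \<theta>k: "\<theta> ^ k = 2 powr (- real k / lam)" for k
    by (simp add: \<theta>_def powr_realpow[symmetric] powr_powr)
  have \<theta>n: "\<theta> ^ n \<le> 1 / 2"
  proof -
    have "\<theta> ^ n \<le> 2 powr (-1)" unfolding \<theta>k using lam by (intro powr_mono) (auto simp: field_simps)
    then show ?thesis by (simp add: powr_minus_divide)
  qed
  \<comment> \<open>\<open>M\<close> is taken so large that the factor
    \<open>(k + 1) powr (- M * lam)\<close> outweighs the loss \<open>(k + 1) powr p\<close> caused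
    by the narrow gaps.\<close>
  obtain M0 :: nat where M0: "p / lam < real M0" using reals_Archimedean2 by blast
  define M where "M = Suc M0"
  have M: "p < real M * lam" using M0 lam by (simp add: M_def field_simps)
  define B where "B = (\<lambda>k. \<theta> ^ k / (real k + 1) ^ M)"
  have B0: "0 < B k" for k using \<theta> by (simp add: B_def)
  have Bpow: "B k \<le> \<theta> ^ k" for k using \<theta> by (simp add: B_def divide_le_eq self_le_power mult_le_cancel_left1)
  have B1: "B k \<le> 1" for k using Bpow[of k] power_le_one[of \<theta> k] \<theta> by linarith
  have BSuc: "B (Suc k) \<le> \<theta> * B k" for k
  proof -
    have "B (Suc k) \<le> \<theta> ^ Suc k / (real k + 1) ^ M"
      unfolding B_def using \<theta> by (intro divide_left_mono power_mono mult_pos_pos) auto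
    then show ?thesis by (simp add: B_def)
  qed
  have dec: "decseq B"
  proof (rule decseq_SucI)
    show "B (Suc k) \<le> B k" for k
      using BSuc[of k] mult_right_mono[of \<theta> 1 "B k"] \<theta> B0[of k] by linarith
  qed
  have Bn: "B (k + n) = \<theta> ^ n * \<theta> ^ k / (real k + real n + 1) ^ M" for k
    unfolding B_def power_add by (simp add: mult.commute)
  have kn: "real k + real n + 1 \<le> (real n + 1) * (real k + 1)" for k by (simp add: algebra_simps)
  define c3 where "c3 = \<theta> ^ n / (real n + 1) ^ M"
  have c3: "0 < c3" using \<theta> by (simp add: c3_def)
  have Bc3: "c3 * B k \<le> B (k + n)" for k
  proof -
    have "c3 * B k = \<theta> ^ n * \<theta> ^ k / ((real n + 1) * (real k + 1)) ^ M"
      by (simp add: c3_def B_def power_mult_distrib)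
    also have "\<dots> \<le> B (k + n)" unfolding Bn
      using \<theta> kn[of k] by (intro divide_left_mono power_mono mult_pos_pos) auto
    finally show ?thesis .
  qed
  \<comment> \<open>One of the \<open>M\<close> polynomial factors is enough here; the others are at
    most 1.\<close>
  have g_decay: "2 * B (k + n) \<le> 2 * \<theta> ^ n * (B k * ((real k + 1) / (real k + real n + 1)))" for k
  proof -
    have "B (k + n) = \<theta> ^ n * (B k * ((real k + 1) / (real k + real n + 1)) ^ M)"
      unfolding Bn by (simp add: B_def power_divide)
    also have "\<dots> \<le> \<theta> ^ n * (B k * ((real k + 1) / (real k + real n + 1)))"
      using \<theta> B0[of k] power_decreasing[of 1 M "(real k + 1) / (real k + real n + 1)"]
      by (intro mult_left_mono) (auto simp: M_def)
    finally show ?thesis by simp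
  qed
  \<comment> \<open>Even when \<open>\<theta> ^ n = 1 / 2\<close> the polynomial factor leaves a gap
    of relative size about \<open>1 / (k + 1)\<close>.\<close>
  have g1: "B k / ((real n + 1) * (real k + 1)) \<le> B k - 2 * B (k + n)" for k
  proof -
    have "2 * B (k + n) \<le> 1 * (B k * ((real k + 1) / (real k + real n + 1)))"
      using g_decay[of k] \<theta>n B0[of k]
      by (elim order_trans) (intro mult_right_mono, auto)
    moreover have "B k * ((real k + 1) / (real k + real n + 1)) = B k - B k * (real n / (real k + real n + 1))"
      by (simp add: field_simps)
    moreover have "B k * (1 / ((real n + 1) * (real k + 1))) \<le> B k * (real n / (real k + real n + 1))"
      using kn[of k] n B0[of k] by (intro mult_left_mono frac_le) auto
    ultimately show ?thesis by simp
  qed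
  have g0: "0 < B k - 2 * B (k + n)" for k
    by (rule order_less_le_trans[OF _ g1[of k]]) (use B0[of k] in simp)
  \<comment> \<open>If \<open>\<theta> ^ n < 1 / 2\<close>, this gives a gap proportional to
    \<open>B k\<close>.\<close>
  have g2: "(1 - 2 * \<theta> ^ n) * B k \<le> B k - 2 * B (k + n)" for k
  proof -
    have "2 * \<theta> ^ n * (B k * ((real k + 1) / (real k + real n + 1))) \<le> 2 * \<theta> ^ n * (B k * 1)"
      using \<theta> B0[of k] by (intro mult_left_mono) auto
    then show ?thesis using g_decay[of k] by (simp add: algebra_simps)
  qed
  define r where "r = (\<lambda>k. min ((B k - 2 * B (k + n)) / 2) (B (k + n)))"
  define c1 where "c1 = min (1 / (2 * (real n + 1))) c3"
  have c1: "0 < c1" using c3 by (simp add: c1_def)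
  have r1: "c1 * B k / (real k + 1) \<le> r k" for k
  proof -
    have "c1 * B k / (real k + 1) \<le> 1 / (2 * (real n + 1)) * B k / (real k + 1)"
      using B0[of k] by (intro divide_right_mono mult_right_mono) (auto simp: c1_def)
    also have "\<dots> = B k / ((real n + 1) * (real k + 1)) / 2" by simp
    also have "\<dots> \<le> (B k - 2 * B (k + n)) / 2" using g1[of k] by (intro divide_right_mono) auto
    finally have 1: "c1 * B k / (real k + 1) \<le> (B k - 2 * B (k + n)) / 2" .
    have "c1 * B k / (real k + 1) \<le> c1 * B k / 1"
      using B0[of k] c1 by (intro divide_left_mono) auto
    also have "\<dots> \<le> c3 * B k" using B0[of k] by (simp add: c1_def)
    also have "\<dots> \<le> B (k + n)" by (rule Bc3)
    finally show ?thesis using 1 by (simp add: r_def)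
  qed
  \<comment> \<open>Room for passages of width \<open>B k powr s\<close>: for \<open>s = 1\<close>
    the gaps are proportional to \<open>B k\<close> because \<open>lam < n\<close>; for
    \<open>s > 1\<close> the exponential decay of \<open>B k powr (s - 1)\<close> beats the factor
    \<open>1 / (k + 1)\<close> in the gaps.\<close>
  obtain c2 where c2: "0 < c2" and r2: "\<And>k. c2 * B k powr s \<le> r k"
  proof (cases "s = 1")
    case True
    have "\<theta> ^ n < 2 powr (-1)" unfolding \<theta>k using lam s1[OF True] by (intro powr_less_mono) (auto simp: field_simps)
    then have t: "0 < 1 - 2 * \<theta> ^ n" by (simp add: powr_minus_divide)
    define c2 where "c2 = min ((1 - 2 * \<theta> ^ n) / 2) c3"
    have "c2 * B k \<le> r k" for k
    proof -
      have "c2 * B k \<le> (1 - 2 * \<theta> ^ n) / 2 * B k" "c2 * B k \<le> c3 * B k"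
        unfolding c2_def using B0[of k]
        by (intro mult_right_mono min.cobounded1 min.cobounded2 less_imp_le, assumption)+
      then show ?thesis using g2[of k] Bc3[of k] by (simp add: r_def)
    qed
    moreover have "0 < c2" using t c3 by (simp add: c2_def)
    ultimately show ?thesis using that[of c2] True B0 by (simp add: less_imp_le)
  next
    case False
    then have s': "s > 1" using s by simp
    have "\<theta> powr (s - 1) < 1" using powr_less_mono'[OF \<theta>, of 0 "s - 1"] \<theta> s' by simp
    then have "1 / \<theta> powr (s - 1) > 1" using \<theta> by (simp add: field_simps)
    from powr_le_const_mult_power[OF this, of 1] obtain D where D: "D > 0"
      "\<And>k::nat. (real k + 1) powr 1 \<le> D * (1 / \<theta> powr (s - 1)) ^ k" by blast
    have "c1 / D * B k powr s \<le> r k" for k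
    proof -
      have "B k powr (s - 1) \<le> (\<theta> ^ k) powr (s - 1)" using Bpow[of k] B0[of k] s' by (intro powr_mono2) auto
      also have "\<dots> = (\<theta> powr (s - 1)) ^ k" using \<theta> by (simp add: powr_realpow[symmetric] powr_powr mult.commute)
      also have "\<dots> \<le> D / (real k + 1)" using D(2)[of k] \<theta> by (simp add: power_divide field_simps)
      finally have "B k powr (s - 1) * B k \<le> D / (real k + 1) * B k" using B0[of k] by (intro mult_right_mono) auto
      moreover have "B k powr s = B k powr (s - 1) * B k" using B0[of k] powr_add[of "B k" "s - 1" 1] by simp
      ultimately have "c1 / D * B k powr s \<le> c1 / D * (D / (real k + 1) * B k)"
        using c1 D(1) by (intro mult_left_mono) auto
      also have "\<dots> = c1 * B k / (real k + 1)" using D(1) by simp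
      finally show ?thesis using r1[of k] by simp
    qed
    then show ?thesis using that[of "c1 / D"] c1 D(1) by simp
  qed
  \<comment> \<open>The factor \<open>c3 powr s\<close> makes the passages narrow enough for the
    rooms one level deeper as well, since \<open>B (Suc k) \<ge> c3 * B k\<close>.\<close>
  define c0 where "c0 = c2 * min 1 (c3 powr s)"
  have c0: "0 < c0" using c2 c3 by (simp add: c0_def)
  define w where "w = (\<lambda>k. c0 * B k powr s)"
  have w0: "0 < w k" for k using c0 B0[of k] by (simp add: w_def)
  have w1: "w k \<le> r k" for k
  proof -
    have "w k \<le> c2 * 1 * B k powr s" unfolding w_def c0_def using c2 by (intro mult_right_mono mult_left_mono) auto
    then show ?thesis using r2[of k] by simp
  qed
  have w2: "w k \<le> r (Suc k)" for k
  proof -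
    have "c3 * B k \<le> B (Suc k)" using Bc3[of k] decseqD[OF dec, of "Suc k" "k + n"] n by simp
    then have "(c3 * B k) powr s \<le> B (Suc k) powr s" using c3 B0[of k] s by (intro powr_mono2) auto
    then have *: "c3 powr s * B k powr s \<le> B (Suc k) powr s" using c3 B0[of k] by (simp add: powr_mult)
    have "w k \<le> c2 * c3 powr s * B k powr s" unfolding w_def c0_def using c2 by (intro mult_right_mono mult_left_mono) auto
    also have "\<dots> \<le> c2 * B (Suc k) powr s" using * c2 by (simp add: mult.assoc)
    finally show ?thesis using r2[of "Suc k"] by simp
  qed
  have rB: "r k \<le> B (k + n)" for k by (simp add: r_def)
  have wB: "B k - B (k + n) + w k \<le> B k" for k using w1[of k] rB[of k] by simp
  \<comment> \<open>The first entry serves \<open>A1\<close>; the second sums the geometric series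
    of passage lengths for \<open>A2\<close>.\<close>
  define C where "C = max (real n) (1 / (1 - \<theta>))"
  have C: "real n \<le> C" "1 / (1 - \<theta>) \<le> C" "0 < C" using n by (auto simp: C_def)
  define A where "A = (\<lambda>k. C * B k)"
  have A1: "real n * (B k - B (k + n) + w k) \<le> A k" for k
    unfolding A_def using wB[of k] C B0 w0[of k] decseqD[OF dec, of k "k + n"] by (intro mult_mono) (auto simp: less_imp_le)
  have A2: "A (Suc k) + (B k - B (k + n)) \<le> A k" for k
  proof -
    have "1 \<le> C * (1 - \<theta>)" using C(2) \<theta> by (simp add: field_simps)
    then have "1 * B k \<le> C * (1 - \<theta>) * B k" using B0[of k] by (intro mult_right_mono) auto
    moreover have "C * B (Suc k) \<le> C * (\<theta> * B k)" using BSuc[of k] C by (intro mult_left_mono) auto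
    ultimately show ?thesis using B0[of "k + n"] by (simp add: A_def algebra_simps)
  qed
  have A3: "c0 / C powr s * A k powr s \<le> w k" for k
    using C(3) B0[of k] by (simp add: A_def w_def powr_mult)
  have content: "\<exists>c>0. \<forall>k. c / 2 ^ k \<le> r k powr q" if q: "0 < q" "q < lam" for q
  proof -
    \<comment> \<open>\<open>y > 1\<close> because \<open>q < lam\<close>; the surplus
      \<open>y ^ k\<close> absorbs the polynomial loss in \<open>r k\<close>, of degree
      \<open>M\<close> from \<open>B\<close> and 1 from the gap.\<close>
    define y where "y = 2 * \<theta> powr q"
    have "y = 2 powr (1 - q / lam)"
      using powr_add[of 2 1 "- q / lam"] by (simp add: y_def \<theta>_def powr_powr)
    moreover have "1 - q / lam > 0" using q lam by simp
    ultimately have y: "y > 1" by (metis gr_one_powr one_less_numeral_iff semiring_norm(76))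
    from powr_le_const_mult_power[OF y, of "real (Suc M) * q"] obtain D where D: "D > 0"
      "\<And>k::nat. (real k + 1) powr (real (Suc M) * q) \<le> D * y ^ k" by blast
    have "c1 powr q / D / 2 ^ k \<le> r k powr q" for k
    proof -
      have k1: "(real k + 1) powr (real (Suc M) * q) > 0" by simp
      have "c1 powr q / D / 2 ^ k = c1 powr q * (\<theta> powr q) ^ k / (D * y ^ k)"
        using \<theta> by (simp add: y_def power_mult_distrib)
      also have "\<dots> \<le> c1 powr q * (\<theta> powr q) ^ k / (real k + 1) powr (real (Suc M) * q)"
        using D y by (intro divide_left_mono D(2) mult_nonneg_nonneg mult_pos_pos) auto
      also have "\<dots> = (c1 * \<theta> ^ k / (real k + 1) ^ Suc M) powr q"
        using \<theta> c1 by (simp add: powr_mult powr_divide powr_realpow[symmetric] powr_powr mult.commute powr_add distrib_left)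
      also have "c1 * \<theta> ^ k / (real k + 1) ^ Suc M = c1 * B k / (real k + 1)"
        by (simp add: B_def field_simps)
      also have "(c1 * B k / (real k + 1)) powr q \<le> r k powr q"
        using r1[of k] c1 B0[of k] q by (intro powr_mono2) auto
      finally show ?thesis .
    qed
    then show ?thesis using c1 D(1) by (intro exI[of _ "c1 powr q / D"]) auto
  qed
  have cap: "(\<lambda>k. (4 / (B k - 2 * B (k + n))) powr p * (2 ^ k * (2 ^ n * ((B k - B (k + n) + w k) * w k ^ (n - 1))))) \<longlonglongrightarrow> 0"
    (is "?f \<longlonglongrightarrow> 0") if Q: "lam \<le> (real n - 1) * s + 1 - p"
  proof -
    define K where "K = (4 * (real n + 1)) powr p * 2 ^ n * c0 ^ (n - 1)"
    have K: "K \<ge> 0" using c0 by (simp add: K_def)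
    have f0: "0 \<le> ?f k" for k
      using w0[of k] decseqD[OF dec, of k "k + n"] by (intro mult_nonneg_nonneg) auto
    have f1: "?f k \<le> K * (real k + 1) powr (p - real M * lam)" for k
    proof -
      have "4 / (B k - 2 * B (k + n)) \<le> 4 / (B k / ((real n + 1) * (real k + 1)))"
        using g0[of k] g1[of k] B0[of k] by (intro divide_left_mono mult_pos_pos) auto
      also have "\<dots> = 4 * (real n + 1) * (real k + 1) / B k" by simp
      finally have "(4 / (B k - 2 * B (k + n))) powr p \<le> (4 * (real n + 1) * (real k + 1) / B k) powr p"
        using g0[of k] p by (intro powr_mono2) auto
      also have "\<dots> = (4 * (real n + 1)) powr p * (real k + 1) powr p * B k powr (- p)"
        using B0[of k] by (simp add: powr_divide powr_mult powr_minus_divide)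
      finally have 1: "(4 / (B k - 2 * B (k + n))) powr p \<le> \<dots>" .
      have wn: "w k ^ (n - 1) = c0 ^ (n - 1) * B k powr ((real n - 1) * s)"
        using B0[of k] n by (simp add: w_def power_mult_distrib powr_realpow[symmetric] powr_powr of_nat_diff mult.commute)
      have 2: "2 ^ n * ((B k - B (k + n) + w k) * w k ^ (n - 1)) \<le> 2 ^ n * (B k * (c0 ^ (n - 1) * B k powr ((real n - 1) * s)))"
        unfolding wn using wB[of k] c0 by (intro mult_left_mono mult_right_mono) auto
      have "?f k \<le> ((4 * (real n + 1)) powr p * (real k + 1) powr p * B k powr (- p)) *
          (2 ^ k * (2 ^ n * (B k * (c0 ^ (n - 1) * B k powr ((real n - 1) * s)))))"
        by (rule mult_mono[OF 1 mult_left_mono[OF 2]]) (use w0[of k] decseqD[OF dec, of k "k + n"] in auto)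
      also have "\<dots> = K * (real k + 1) powr p * 2 ^ k * (B k powr (- p) * B k powr 1 * B k powr ((real n - 1) * s))"
        using B0[of k] by (simp add: K_def)
      \<comment> \<open>The three exponents stem from the gap, the length and the cross-section of a
        passage. As \<open>B k \<le> 1\<close>, lowering their sum to \<open>lam\<close> afterwards
        only enlarges the power.\<close>
      also have "B k powr (- p) * B k powr 1 * B k powr ((real n - 1) * s) = B k powr ((real n - 1) * s + 1 - p)"
        unfolding powr_add[symmetric] by (rule arg_cong[where f = "(powr) (B k)"]) simp
      also have "\<dots> \<le> B k powr lam" using Q B0[of k] B1[of k] by (intro powr_mono') auto
      \<comment> \<open>By the choice of \<open>\<theta>\<close> this cancels the number
        \<open>2 ^ k\<close> of passages and leaves a polynomial factor.\<close>
      also have "B k powr lam = 1 / 2 ^ k / (real k + 1) powr (real M * lam)"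
        using \<theta> lam unfolding B_def \<theta>k
        by (simp add: powr_divide powr_mult powr_powr powr_realpow[symmetric] powr_minus_divide)
      also have "K * (real k + 1) powr p * 2 ^ k * (1 / 2 ^ k / (real k + 1) powr (real M * lam)) = K * (real k + 1) powr (p - real M * lam)"
        by (simp add: powr_diff)
      finally show ?thesis using K by (simp add: mult_left_mono)
    qed
    have "(\<lambda>k::nat. K * (real k + 1) powr (p - real M * lam)) \<longlonglongrightarrow> K * 0"
    proof (intro tendsto_mult tendsto_const)
      have "p - real M * lam < 0" using M by simp
      then show "(\<lambda>k::nat. (real k + 1) powr (p - real M * lam)) \<longlonglongrightarrow> 0" by real_asymp
    qed
    then show ?thesis by (intro real_tendsto_sandwich[OF _ _ tendsto_const, of 0 ?f]) (use f0 f1 in auto)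
  qed
  show ?thesis
  proof (rule that[OF dec _ rB w0 w1 w2 _ A1 A2 A3 content cap])
    show "2 * r k \<le> B k - 2 * B (k + n)" for k
    proof -
      have "r k \<le> (B k - 2 * B (k + n)) / 2" unfolding r_def by (rule min.cobounded1)
      then show ?thesis by simp
    qed
    show "0 < c0 / C powr s" using c0 C by simp
  qed
qed

section \<open>The domain, the sets and the limits put together\<close>

theorem theorem1p3:
  fixes s p :: real
  assumes "CARD('n::finite) \<ge> 2" and "s \<ge> 1" and "1 \<le> p" and "p \<le> real CARD('n)"
  shows "\<exists>(\<Omega> :: (real^'n) set) x0.
    s_John_domain s \<Omega> x0 \<and>
    (\<exists>W. Whitney_decomposition \<Omega> W) \<and>
    (\<forall>W Q0. Whitney_decomposition \<Omega> W \<and> Q0 \<in> W \<and> x0 \<in> Q0 \<longrightarrow>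
      (\<exists>E :: nat \<Rightarrow> (real^'n) set.
        (\<forall>j\<ge>1. compact (E j) \<and> E j \<subseteq> \<Omega>) \<and>
        (\<forall>j\<ge>1. E j \<inter> Q0 = {}) \<and>
        (\<forall>q::real. 0 < q \<and> q < min ((real CARD('n) - 1) * s + 1 - p) (real CARD('n)) \<longrightarrow>
          (\<exists>c::real. c > 0 \<and> (\<forall>j\<ge>1. Hausdorff_content q (E j) \<ge> ennreal c)) \<and>
          (\<lambda>j. Capacity p (E j) Q0 \<Omega>) \<longlonglongrightarrow> 0)))"
proof -
  let ?n = "CARD('n)"
  define Q where "Q = (real ?n - 1) * s + 1 - p"
  \<comment> \<open>If \<open>Q = 0\<close> no \<open>q\<close> is admissible, and any positive \<open>lam < n\<close> gives a John domain.\<close>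
  define lam where "lam = (if Q > 0 then min Q (real ?n) else 1)"
  have lam: "0 < lam" "lam \<le> real ?n" using assms(1) by (auto simp: lam_def)
  \<comment> \<open>For \<open>s = 1\<close> either \<open>lam \<le> Q \<le> n - 1\<close>, because
    \<open>p \<ge> 1\<close>, or \<open>lam = 1\<close>; both are below the dimension
    \<open>n\<close>.\<close>
  have s1: "lam < real ?n" if "s = 1" using that assms(1,3) by (auto simp: lam_def Q_def)
  obtain B r w A :: "nat \<Rightarrow> real" and c :: real where
    par: "decseq B" "\<And>k. 2 * r k \<le> B k - 2 * B (k + ?n)" "\<And>k. r k \<le> B (k + ?n)"
      "\<And>k. 0 < w k" "\<And>k. w k \<le> r k" "\<And>k. w k \<le> r (Suc k)"
    and A: "0 < c" "\<And>k. real ?n * (B k - B (k + ?n) + w k) \<le> A k"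
      "\<And>k. A (Suc k) + (B k - B (k + ?n)) \<le> A k" "\<And>k. c * A k powr s \<le> w k"
    and content: "\<And>q. 0 < q \<Longrightarrow> q < lam \<Longrightarrow> \<exists>c>0. \<forall>k. c / 2 ^ k \<le> r k powr q"
    and cap: "lam \<le> Q \<Longrightarrow> (\<lambda>k. (4 / (B k - 2 * B (k + ?n))) powr p *
        (2 ^ k * (2 ^ ?n * ((B k - B (k + ?n) + w k) * w k ^ (?n - 1))))) \<longlonglongrightarrow> 0"
    by (rule ex_parameters[OF assms(1,2,3) lam, folded Q_def], erule s1) (rule that; (assumption | erule meta_spec | blast))
  define h where "h = (\<lambda>k. B k - B (k + ?n))"
  define g where "g = (\<lambda>k. B k - 2 * B (k + ?n))"
  obtain \<alpha> :: "nat \<Rightarrow> 'n" and b where "folding_tree \<alpha> b h g r w"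
    unfolding h_def g_def using ex_folding_tree[OF assms(1) par] by blast
  then interpret folding_tree \<alpha> b h g r w .
  have John: "s_John_domain s Dom 0"
    by (rule s_John_domain_Dom[OF assms(2) A(1), of A]) (use A in \<open>simp_all add: h_def\<close>)
  moreover have "\<exists>W. Whitney_decomposition Dom W"
    using zero_in_Dom by (intro ex_Whitney_decomposition open_Dom bounded_Dom) auto
  moreover have "\<exists>E :: nat \<Rightarrow> (real^'n) set.
        (\<forall>j\<ge>1. compact (E j) \<and> E j \<subseteq> Dom) \<and>
        (\<forall>j\<ge>1. E j \<inter> Q0 = {}) \<and>
        (\<forall>q::real. 0 < q \<and> q < min ((real ?n - 1) * s + 1 - p) (real ?n) \<longrightarrow>
          (\<exists>c::real. c > 0 \<and> (\<forall>j\<ge>1. Hausdorff_content q (E j) \<ge> ennreal c)) \<and>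
          (\<lambda>j. Capacity p (E j) Q0 Dom) \<longlonglongrightarrow> 0)"
    if W: "Whitney_decomposition Dom W \<and> Q0 \<in> W \<and> 0 \<in> Q0" for W Q0
  proof -
    \<comment> \<open>As 0 lies in \<open>Q0\<close>, the Whitney condition bounds the diameter of
      \<open>Q0\<close> by the distance of 0 to the frontier, hence by \<open>r 0\<close>.\<close>
    have Q0: "\<bar>x $ a\<bar> \<le> r 0" if x: "x \<in> Q0" for x a
    proof -
      have Qd: "diameter Q0 \<le> setdist Q0 (frontier Dom)" "closed_cube Q0"
        using W by (auto simp: Whitney_decomposition_def)
      have "frontier Dom \<noteq> {}"
        using zero_in_Dom bounded_Dom by (metis frontier_not_empty not_bounded_UNIV empty_iff)
      then have i: "infdist 0 (frontier Dom) = setdist {0} (frontier Dom)" by (simp add: infdist_eq_setdist)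
      have "\<bar>x $ a\<bar> \<le> dist 0 x" using component_le_norm_cart[of x a] by simp
      also have "\<dots> \<le> diameter Q0"
        using Qd(2) x W by (intro diameter_bounded_bound) (auto simp: closed_cube_def)
      also have "\<dots> \<le> setdist Q0 (frontier Dom)" by (rule Qd(1))
      also have "\<dots> \<le> infdist 0 (frontier Dom)" unfolding i using W by (intro setdist_subset_left) auto
      also have "\<dots> \<le> r 0" by (rule infdist_frontier_Dom_le)
      finally show ?thesis .
    qed
    \<comment> \<open>The shift by one level puts all passages of level \<open>j\<close> between
      \<open>E j\<close> and the root.\<close>
    define E where "E = (\<lambda>j. core (Suc j) 0)"
    have E_piece: "E j \<subseteq> piece (Suc j)" for j unfolding E_def by (rule core_subset_piece)
    have "E j \<inter> Q0 = {}" for j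
    proof (rule ccontr)
      assume "E j \<inter> Q0 \<noteq> {}"
      then obtain x where x: "x \<in> piece (Suc j)" "x \<in> Q0" using E_piece by blast
      \<comment> \<open>Pieces of positive level stay at least \<open>g 0 > r 0\<close> away from
        the first crease, which the central cube does not reach.\<close>
      have "F (Suc 0) x \<in> Box (Suc 0)" using Box_mono[OF F_piece_Box[OF x(1)], of "Suc 0"] by simp
      from Box_Suc(2)[OF this] show False using Q0[OF x(2), of "\<alpha> 0"] r_less_g[of 0] by simp
    qed
    moreover have "compact (E j) \<and> E j \<subseteq> Dom" for j
      using compact_core[of "Suc j"] E_piece[of j] unfolding Dom_def E_def by blast
    moreover have "(\<exists>c::real. c > 0 \<and> (\<forall>j\<ge>1. Hausdorff_content q (E j) \<ge> ennreal c)) \<and>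
          (\<lambda>j. Capacity p (E j) Q0 Dom) \<longlonglongrightarrow> 0"
      if q: "0 < q \<and> q < min ((real ?n - 1) * s + 1 - p) (real ?n)" for q
    proof
      \<comment> \<open>The existence of an admissible \<open>q\<close> forces \<open>Q > 0\<close>,
        so \<open>lam\<close> is the minimum of \<open>Q\<close> and the dimension.\<close>
      have Qpos: "0 < Q" "q < lam" "lam \<le> Q" using q by (auto simp: lam_def Q_def)
      obtain c' where c': "c' > 0" "\<And>k. c' / 2 ^ k \<le> r k powr q" using content[of q] q Qpos by blast
      have "ennreal (c' / 2 ^ ?n) \<le> Hausdorff_content q (E j)" for j
        unfolding E_def using q c' by (intro Hausdorff_content_core_ge) auto
      then show "\<exists>c::real. c > 0 \<and> (\<forall>j\<ge>1. Hausdorff_content q (E j) \<ge> ennreal c)"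
        using c'(1) by (intro exI[of _ "c' / 2 ^ ?n"]) simp
      let ?f = "\<lambda>j. (4 / g j) powr p * (2 ^ j * (2 ^ ?n * ((h j + w j) * w j ^ (?n - 1))))"
      have "?f \<longlonglongrightarrow> 0" using cap Qpos by (simp add: g_def h_def)
      from tendsto_ennrealI[OF this] have lim: "(\<lambda>j. ennreal (?f j)) \<longlonglongrightarrow> 0" by simp
      have "Capacity p (E j) Q0 Dom \<le> ennreal (?f j)" if "1 \<le> j" for j
        by (rule Capacity_le[OF assms(3) that E_piece]) (rule Q0)
      then have "\<forall>\<^sub>F j in sequentially. Capacity p (E j) Q0 Dom \<le> ennreal (?f j)"
        by (rule eventually_sequentiallyI)
      then show "(\<lambda>j. Capacity p (E j) Q0 Dom) \<longlonglongrightarrow> 0"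
        by (intro tendsto_sandwich[OF _ _ tendsto_const lim]) auto
    qed
    ultimately show ?thesis by blast
  qed
  ultimately show ?thesis by blast
qed

end
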